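(* Let $\mathbb{F}$ be a totally ordered division ring and let $L$ be a finite lower bounded lattice. Then: (1) $L$ has a plenary, zero-preserving lattice embedding into $\mathbf{K}(\mathbb{F}^n)$, for some natural number $n$. (2) $L$ has a zero-preserving lattice embedding into a lower bounded lattice of the form $\mathbf{Co}(\mathbb{Q}^n,\Omega)$, for some natural number $n$ and some plenary (in $\mathbb{Q}^n$) finite subset $\Omega$ of $\mathbb{Z}^n$.
   Context: All vector spaces are left vector spaces. Let $V$ be a vector space over a totally ordered division ring $\mathbb{F}$. A subset $X\subseteq V$ is convex if $\xi_0x+\xi_1y\in X$ whenever $x,y\in X$, $\xi_0,\xi_1\geq 0$ in $\mathbb{F}$ and $\xi_0+\xi_1=1$. $\mathbf{Co}(V)$ is the lattice, under inclusion, of all convex subsets of $V$ (including $\varnothing$). $\mathrm{Co}(X)$ denotes the convex hull of $X\subseteq V$. $\mathbf{K}(V)$ is the sublattice of $\mathbf{Co}(V)$ consisting of all convex polytopes of $V$, that is, the convex hulls of finite subsets of $V$ (including $\varnothing$). For $\Omega\subseteq V$, $\mathbf{Co}(V,\Omega)=\{X\cap\Omega\mid X\in\mathbf{Co}(V)\}$, a lattice under inclusion; $\varphi_\Omega\colon\mathbf{Co}(V,\Omega)\to\mathbf{Co}(V)$ is the map $X\mapsto\mathrm{Co}(X)$. A subset $\Omega$ of $V$ is plenary if for every $x\in\mathrm{Co}(\Omega)$ there exists a least $X\in\mathbf{Co}(V,\Omega)$ such that $x\in\mathrm{Co}(X)$. A map $f\colon K\to K'$ between posets preserves existing meets if whenever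 $X\subseteq K$ has a meet in $K$, the image $f[X]$ has a meet in $K'$ and $\bigwedge f[X]=f(\bigwedge X)$. It is zero-preserving if whenever $K$ has a smallest element $0_K$, $f(0_K)$ is the smallest element of $K'$. For a join-semilattice $L$, a map $\varphi\colon L\to\mathbf{Co}(V)$ is plenary if $\varphi=\varphi_\Omega\circ\psi$ for some plenary subset $\Omega$ of $V$ and some join-homomorphism $\psi\colon L\to\mathbf{Co}(V,\Omega)$ that preserves existing meets. A map into $\mathbf{K}(V)$ is called plenary if it is plenary as a map into $\mathbf{Co}(V)$. Lower bounded lattices: a lattice homomorphism $h\colon K\to L$ is lower bounded if for every $a\in L$ the set $\{x\in K\mid h(x)\geq a\}$ is either empty or has a least element. A finitely generated lattice $L$ is lower bounded if it is the homomorphic image of a finitely generated free lattice under a lower bounded lattice homomorphism. Equivalently, for finite $L$, the relation $D$ on the set $\mathrm{J}(L)$ of join-irreducible elements has no cycle $a_0\mathbin{D}\cdots\mathbin{D}a_{n-1}\mathbin{D}a_0$, where: $L^-=L\setminus\{0\}$ if $L$ has a least element $0$ and $L^-=L$ otherwise; for subsets $X,Y$ of $L$, $X\ll Y$ means every element of $X$ lies below some element of $Y$; a nontrivial join-cover of $a\in L^-$ is a finite $X\subseteq L^-$ with $a\leq\bigvee X$ and $a\nleq x$ for all $x\in X$; it is minimal if $Y\ll X$ implies $X\subseteq Y$ for every nontrivial join-cover $Y$ of $a$; and $a\mathbin{D}b$ if $b$ belongs to a minimal nontrivial join-cover of $a$. *)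

theory Defs
  imports Complex_Main "HOL-Algebra.Lattice"
begin

section \<open>Lattices of convex subsets of coordinate spaces over a totally ordered division ring\<close>

text \<open>
  A totally ordered division ring is a type of sort
  \<open>{division_ring, linordered_ring_strict}\<close>; commutativity is not assumed.
  The left vector space of \<open>n\<close>-tuples over it is the set of sequences that vanish from
  index \<open>n\<close> on, with pointwise operations and scalars acting from the left, so that the
  dimension can be quantified over.
\<close>

definition coord_space :: "nat \<Rightarrow> (nat \<Rightarrow> 'a::zero) set" where
  "coord_space n = {x. \<forall>i\<ge>n. x i = 0}"

definition convex_set ::
    "(nat \<Rightarrow> 'a::{division_ring, linordered_ring_strict}) set \<Rightarrow> bool" where
  "convex_set X \<longleftrightarrow>
     (\<forall>x\<in>X. \<forall>y\<in>X. \<forall>\<xi>\<^sub>0 \<xi>\<^sub>1. 0 \<le> \<xi>\<^sub>0 \<longrightarrow> 0 \<le> \<xi>\<^sub>1 \<longrightarrow> \<xi>\<^sub>0 + \<xi>\<^sub>1 = 1 \<longrightarrow>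
        (\<lambda>i. \<xi>\<^sub>0 * x i + \<xi>\<^sub>1 * y i) \<in> X)"

text \<open>
  The coordinate space is itself convex, so for its subsets the hull below does not depend
  on the dimension in which it is formed.
\<close>

abbreviation convex_hull_of ::
    "(nat \<Rightarrow> 'a::{division_ring, linordered_ring_strict}) set
      \<Rightarrow> (nat \<Rightarrow> 'a) set" where
  "convex_hull_of X \<equiv> convex_set hull X"

abbreviation inclusion_order :: "'a set set \<Rightarrow> 'a set gorder" where
  "inclusion_order C \<equiv> \<lparr>carrier = C, eq = (=), le = (\<subseteq>)\<rparr>"

definition Co ::
    "nat \<Rightarrow> (nat \<Rightarrow> 'a::{division_ring, linordered_ring_strict}) set gorder" where
  "Co n = inclusion_order {X. X \<subseteq> coord_space n \<and> convex_set X}"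

definition polytopes ::
    "nat \<Rightarrow> (nat \<Rightarrow> 'a::{division_ring, linordered_ring_strict}) set gorder" where
  "polytopes n =
     inclusion_order {convex_hull_of S | S. finite S \<and> S \<subseteq> coord_space n}"

definition Co_rel ::
    "nat \<Rightarrow> (nat \<Rightarrow> 'a::{division_ring, linordered_ring_strict}) set
      \<Rightarrow> (nat \<Rightarrow> 'a) set gorder" where
  "Co_rel n \<Omega> = inclusion_order {X \<inter> \<Omega> | X. X \<in> carrier (Co n)}"

definition plenary_set ::
    "nat \<Rightarrow> (nat \<Rightarrow> 'a::{division_ring, linordered_ring_strict}) set \<Rightarrow> bool" where
  "plenary_set n \<Omega> \<longleftrightarrow>
     \<Omega> \<subseteq> coord_space n \<and>
     (\<forall>x \<in> convex_hull_of \<Omega>.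
        \<exists>X. least (Co_rel n \<Omega>) X {Y \<in> carrier (Co_rel n \<Omega>). x \<in> convex_hull_of Y})"

section \<open>Maps between posets and lattices\<close>

definition preserves_existing_meets :: "'a gorder \<Rightarrow> 'b gorder \<Rightarrow> ('a \<Rightarrow> 'b) \<Rightarrow> bool" where
  "preserves_existing_meets K K' f \<longleftrightarrow>
     (\<forall>X m. X \<subseteq> carrier K \<longrightarrow> is_glb K m X \<longrightarrow> is_glb K' (f m) (f ` X))"

definition zero_preserving :: "'a gorder \<Rightarrow> 'b gorder \<Rightarrow> ('a \<Rightarrow> 'b) \<Rightarrow> bool" where
  "zero_preserving K K' f \<longleftrightarrow>
     (\<forall>z. least K z (carrier K) \<longrightarrow> least K' (f z) (carrier K'))"

text \<open>
  The library predicates \<^const>\<open>join_pres\<close> and \<^const>\<open>meet_pres\<close> include that both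
  structures are lattices.
\<close>

definition lattice_hom :: "'a gorder \<Rightarrow> 'b gorder \<Rightarrow> ('a \<Rightarrow> 'b) \<Rightarrow> bool" where
  "lattice_hom K L h \<longleftrightarrow>
     h \<in> carrier K \<rightarrow> carrier L \<and> join_pres K L h \<and> meet_pres K L h"

definition lattice_embedding :: "'a gorder \<Rightarrow> 'b gorder \<Rightarrow> ('a \<Rightarrow> 'b) \<Rightarrow> bool" where
  "lattice_embedding K L h \<longleftrightarrow> lattice_hom K L h \<and> inj_on h (carrier K)"

definition plenary_map ::
    "nat \<Rightarrow> 'l gorder
      \<Rightarrow> ('l \<Rightarrow> (nat \<Rightarrow> 'a::{division_ring, linordered_ring_strict}) set) \<Rightarrow> bool" where
  "plenary_map n L \<phi> \<longleftrightarrow>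
     (\<exists>\<Omega> \<psi>. plenary_set n \<Omega> \<and>
        \<psi> \<in> carrier L \<rightarrow> carrier (Co_rel n \<Omega>) \<and>
        (\<forall>a\<in>carrier L. \<forall>b\<in>carrier L. \<psi> (a \<squnion>\<^bsub>L\<^esub> b) = \<psi> a \<squnion>\<^bsub>Co_rel n \<Omega>\<^esub> \<psi> b) \<and>
        preserves_existing_meets L (Co_rel n \<Omega>) \<psi> \<and>
        (\<forall>a\<in>carrier L. \<phi> a = convex_hull_of (\<psi> a)))"

section \<open>Free lattices and lower bounded lattices\<close>

datatype (lvars: 'x) lterm = LVar 'x | LJoin "'x lterm" "'x lterm" | LMeet "'x lterm" "'x lterm"

text \<open>
  The least preorder on lattice terms for which \<open>LJoin\<close> and \<open>LMeet\<close> are binary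
  suprema and infima. Two terms are identified in the free lattice iff they are equivalent
  for this preorder.
\<close>

inductive lterm_le :: "'x lterm \<Rightarrow> 'x lterm \<Rightarrow> bool" where
  refl: "lterm_le s s"
| trans: "lterm_le s t \<Longrightarrow> lterm_le t u \<Longrightarrow> lterm_le s u"
| join_upper1: "lterm_le s (LJoin s t)"
| join_upper2: "lterm_le t (LJoin s t)"
| join_least: "lterm_le s u \<Longrightarrow> lterm_le t u \<Longrightarrow> lterm_le (LJoin s t) u"
| meet_lower1: "lterm_le (LMeet s t) s"
| meet_lower2: "lterm_le (LMeet s t) t"
| meet_greatest: "lterm_le u s \<Longrightarrow> lterm_le u t \<Longrightarrow> lterm_le u (LMeet s t)"

definition lterm_equiv :: "'x set \<Rightarrow> ('x lterm \<times> 'x lterm) set" where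
  "lterm_equiv X =
     {(s, t). lvars s \<subseteq> X \<and> lvars t \<subseteq> X \<and> lterm_le s t \<and> lterm_le t s}"

definition free_lattice :: "'x set \<Rightarrow> 'x lterm set gorder" where
  "free_lattice X =
     \<lparr>carrier = {t. lvars t \<subseteq> X} // lterm_equiv X,
      eq = (=),
      le = (\<lambda>A B. \<exists>s\<in>A. \<exists>t\<in>B. lterm_le s t)\<rparr>"

definition lower_bounded_hom :: "'a gorder \<Rightarrow> 'b gorder \<Rightarrow> ('a \<Rightarrow> 'b) \<Rightarrow> bool" where
  "lower_bounded_hom K L h \<longleftrightarrow>
     lattice_hom K L h \<and>
     (\<forall>a\<in>carrier L. {x \<in> carrier K. a \<sqsubseteq>\<^bsub>L\<^esub> h x} = {} \<or>
        (\<exists>m. least K m {x \<in> carrier K. a \<sqsubseteq>\<^bsub>L\<^esub> h x}))"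

text \<open>
  Every finitely generated free lattice is isomorphic to one on generators
  \<open>0, \<dots>, k - 1\<close>.
\<close>

definition lower_bounded_lattice :: "'a gorder \<Rightarrow> bool" where
  "lower_bounded_lattice L \<longleftrightarrow>
     (\<exists>k::nat. \<exists>h. lower_bounded_hom (free_lattice {..<k}) L h \<and>
        h ` carrier (free_lattice {..<k}) = carrier L)"

end

theory Submission
  imports Defs
begin

text \<open>
  The image of an element \<open>a\<close> of \<open>L\<close> will be the convex hull of \<open>\<psi> a = {z \<in> \<Omega>. e z \<sqsubseteq> a}\<close>,
  where \<open>\<Omega>\<close> is a finite set of points with a map \<open>e\<close> from \<open>\<Omega>\<close> onto the nonzero elements of \<open>L\<close>.
  Any such \<open>\<psi>\<close> preserves meets and separates elements. What has to be arranged is that every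
  \<open>\<psi> a\<close> is the trace on \<open>\<Omega>\<close> of a convex set (labels respect convex combinations), that joins are
  preserved (whenever \<open>e z \<sqsubseteq> a \<squnion> b\<close>, the point \<open>z\<close> lies in the hull of \<open>\<psi> a \<union> \<psi> b\<close>), and that
  \<open>\<Omega>\<close> is plenary; plenarity is also what makes the hulls of \<open>\<psi> a\<close> and \<open>\<psi> b\<close> meet exactly
  in the hull of \<open>\<psi> a \<inter> \<psi> b\<close>.

  Lower boundedness of \<open>L\<close> enters through one consequence, \<open>lower_bounded_split_rank\<close>: there is a
  rank on \<open>L\<close> such that every \<open>p \<sqsubseteq> a \<squnion> b\<close> with \<open>p\<close> below neither side is already below
  \<open>a' \<squnion> b'\<close> for some \<open>a' \<sqsubseteq> a\<close> and \<open>b' \<sqsubseteq> b\<close> of smaller rank than \<open>p\<close>. The rank of \<open>p\<close> is the size of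
  a shortest term for the least preimage of \<open>p\<close> in a free lattice, and the decrease comes from
  Whitman's condition: a term that lies below a join without lying below a side splits into
  two shorter terms (\<open>split_below_join\<close>).

  The set \<open>\<Omega>\<close> starts as a simplex with one vertex for each nonzero element. If a point
  \<open>\<omega>\<close> still needs to be covered by labels \<open>a'\<close> and \<open>b'\<close>, a new coordinate is opened and the two
  points \<open>\<omega> + u\<close> and \<open>\<omega> - u\<close>, with \<open>u\<close> the new unit vector, receive these labels; their midpoint is
  \<open>\<omega>\<close>. The rank of the labels drops, so the process stops. A fresh direction
  creates no accidental incidences: a convex combination that uses both new points can trade equal
  amounts of them for \<open>\<omega>\<close>, and what remains uses at most one of them, with a weight that can be read
  off from the new coordinate (\<open>combination_split\<close>). All invariants follow from this, and all
  coordinates stay integral.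

  A point in the hull of other points lies already in the hull of those among them whose labels have
  lower rank, so the lattice of traces on
  \<open>\<Omega>\<close> satisfies a ranked covering criterion for lower boundedness (\<open>lower_bounded_if_ranked\<close>). That
  the polytopes form a lattice needs the intersection of two polytopes to be a polytope
  (\<open>polytope_Int\<close>), which is shown by a minimal-support argument that works over noncommutative scalars.
\<close>

section \<open>Whitman's solution of the word problem for free lattices\<close>

text \<open>
  The order on lattice terms without a transitivity rule. Every rule decomposes a side of the
  inequality, so that an inequality between a meet and a join can be analysed by cases.
\<close>

inductive whitman_le :: "'x lterm \<Rightarrow> 'x lterm \<Rightarrow> bool" where
  var: "whitman_le (LVar x) (LVar x)"
| joinL: "whitman_le s u \<Longrightarrow> whitman_le t u \<Longrightarrow> whitman_le (LJoin s t) u"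
| meetR: "whitman_le u s \<Longrightarrow> whitman_le u t \<Longrightarrow> whitman_le u (LMeet s t)"
| joinR1: "whitman_le s t \<Longrightarrow> whitman_le s (LJoin t u)"
| joinR2: "whitman_le s u \<Longrightarrow> whitman_le s (LJoin t u)"
| meetL1: "whitman_le s u \<Longrightarrow> whitman_le (LMeet s t) u"
| meetL2: "whitman_le t u \<Longrightarrow> whitman_le (LMeet s t) u"

lemma whitman_le_refl: "whitman_le t t"
  by (induction t) (auto intro: whitman_le.intros)

lemma whitman_le_LJoinD: "whitman_le (LJoin s t) u \<Longrightarrow> whitman_le s u \<and> whitman_le t u"
  by (induction "LJoin s t" u rule: whitman_le.induct) (auto intro: whitman_le.intros)

lemma whitman_le_LMeetD: "whitman_le u (LMeet s t) \<Longrightarrow> whitman_le u s \<and> whitman_le u t"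
  by (induction u "LMeet s t" rule: whitman_le.induct) (auto intro: whitman_le.intros)

text \<open>
  Cut elimination. The rules with a join on the left and with a meet on the right are invertible,
  so for each shape of the middle term one of the two derivations can be inverted and the other one
  followed by induction.
\<close>

lemma whitman_le_trans: "whitman_le s t \<Longrightarrow> whitman_le t u \<Longrightarrow> whitman_le s u"
proof (induction t arbitrary: s u)
  case (LVar x)
  from LVar.prems show ?case
    by (induction s "LVar x" rule: whitman_le.induct) (auto intro: whitman_le.intros)
next
  case (LJoin t1 t2)
  note cut = LJoin.IH
  have "whitman_le t1 u" "whitman_le t2 u"
    using whitman_le_LJoinD[OF LJoin.prems(2)] by auto
  with LJoin.prems(1) show ?case
    by (induction s "LJoin t1 t2" rule: whitman_le.induct) (auto intro: whitman_le.intros cut)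
next
  case (LMeet t1 t2)
  note cut = LMeet.IH
  have "whitman_le s t1" "whitman_le s t2"
    using whitman_le_LMeetD[OF LMeet.prems(1)] by auto
  with LMeet.prems(2) show ?case
    by (induction "LMeet t1 t2" u rule: whitman_le.induct) (auto intro: whitman_le.intros cut)
qed

lemma whitman_le_iff_lterm_le: "whitman_le s t \<longleftrightarrow> lterm_le s t"
proof
  show "whitman_le s t \<Longrightarrow> lterm_le s t"
    by (induction rule: whitman_le.induct) (blast intro: lterm_le.intros)+
  show "lterm_le s t \<Longrightarrow> whitman_le s t"
    by (induction rule: lterm_le.induct)
      (auto intro: whitman_le.intros whitman_le_refl whitman_le_trans)
qed

lemma LVar_le_LJoinD: "lterm_le (LVar x) (LJoin u v) \<Longrightarrow> lterm_le (LVar x) u \<or> lterm_le (LVar x) v"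
  unfolding whitman_le_iff_lterm_le[symmetric] by (cases rule: whitman_le.cases) auto

lemma whitman_condition:
  "lterm_le (LMeet s t) (LJoin u v) \<Longrightarrow>
     lterm_le (LMeet s t) u \<or> lterm_le (LMeet s t) v \<or> lterm_le s (LJoin u v) \<or> lterm_le t (LJoin u v)"
  unfolding whitman_le_iff_lterm_le[symmetric] by (erule whitman_le.cases) auto

lemma LJoin_le_iff: "lterm_le (LJoin s t) u \<longleftrightarrow> lterm_le s u \<and> lterm_le t u"
  unfolding whitman_le_iff_lterm_le[symmetric] using whitman_le_LJoinD whitman_le.joinL by blast

lemma le_LMeet_iff: "lterm_le u (LMeet s t) \<longleftrightarrow> lterm_le u s \<and> lterm_le u t"
  unfolding whitman_le_iff_lterm_le[symmetric] using whitman_le_LMeetD whitman_le.meetR by blast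

lemma le_LJoinI1: "lterm_le s t \<Longrightarrow> lterm_le s (LJoin t u)"
  by (rule lterm_le.trans[OF _ lterm_le.join_upper1])

lemma le_LJoinI2: "lterm_le s u \<Longrightarrow> lterm_le s (LJoin t u)"
  by (rule lterm_le.trans[OF _ lterm_le.join_upper2])

lemma LMeet_leI1: "lterm_le s u \<Longrightarrow> lterm_le (LMeet s t) u"
  by (rule lterm_le.trans[OF lterm_le.meet_lower1])

lemma LMeet_leI2: "lterm_le t u \<Longrightarrow> lterm_le (LMeet s t) u"
  by (rule lterm_le.trans[OF lterm_le.meet_lower2])

text \<open>
  The terms \<open>a\<close> and \<open>b\<close> replace \<open>u\<close> and \<open>v\<close> in a join above \<open>t\<close>; that they are shorter than
  \<open>t\<close> makes the rank decrease.
\<close>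

definition split_parts :: "'x lterm \<Rightarrow> 'x lterm \<Rightarrow> 'x lterm \<Rightarrow> 'x lterm \<Rightarrow> 'x lterm \<Rightarrow> bool" where
  "split_parts u v t a b \<longleftrightarrow> lvars a \<union> lvars b \<subseteq> lvars t \<and> size a < size t \<and> size b < size t \<and>
     lterm_le a u \<and> lterm_le b v \<and> lterm_le t (LJoin a b)"

lemma split_parts_mono:
  assumes "split_parts u v s a b" "lterm_le t s" "lvars s \<subseteq> lvars t" "size s < size t"
  shows "split_parts u v t a b"
  using assms unfolding split_parts_def
  using lterm_le.trans[of t s "LJoin a b"] by auto

lemma LJoin_mono: "lterm_le s s' \<Longrightarrow> lterm_le t t' \<Longrightarrow> lterm_le (LJoin s t) (LJoin s' t')"
  by (simp add: LJoin_le_iff le_LJoinI1 le_LJoinI2)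

lemma split_partsI:
  assumes "lvars a \<union> lvars b \<subseteq> lvars t" "size a < size t" "size b < size t"
    "lterm_le a u" "lterm_le b v" "lterm_le t (LJoin a b)"
  shows "split_parts u v t a b"
  using assms unfolding split_parts_def by blast

lemma LJoin_swap_right: "lterm_le (LJoin (LJoin a b) t) (LJoin (LJoin a t) b)"
  and LJoin_assoc_right: "lterm_le (LJoin (LJoin a b) t) (LJoin a (LJoin b t))"
  and LJoin_assoc_left: "lterm_le (LJoin s (LJoin a b)) (LJoin (LJoin s a) b)"
  and LJoin_swap_left: "lterm_le (LJoin s (LJoin a b)) (LJoin a (LJoin s b))"
  by (simp_all add: LJoin_le_iff le_LJoinI1 le_LJoinI2 lterm_le.refl)

lemma LJoin_interchange:
  "lterm_le (LJoin (LJoin a b) (LJoin c d)) (LJoin (LJoin a c) (LJoin b d))"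
  by (simp add: LJoin_le_iff le_LJoinI1 le_LJoinI2 lterm_le.refl)

text \<open>
  Variables are join prime, and Whitman's condition passes from a meet to one of its two parts, so
  the inequality can be pushed down into \<open>t\<close> until it is trivial. At a join the pieces found in both
  parts are collected; they are shorter than \<open>t\<close> because at least one piece was dropped or shortened on
  each side.
\<close>

lemma split_below_join:
  assumes "lterm_le t (LJoin u v)"
  shows "lterm_le t u \<or> lterm_le t v \<or> (\<exists>a b. split_parts u v t a b)"
  using assms
proof (induction t)
  case (LVar x)
  from LVar_le_LJoinD[OF this] show ?case by (elim disjE) simp_all
next
  case (LMeet s t)
  have split: "split_parts u v (LMeet s t) a b" if "split_parts u v s a b \<or> split_parts u v t a b" for a b
    using that
  proof
    assume "split_parts u v s a b" then show ?thesis
      by (rule split_parts_mono) (auto intro: lterm_le.meet_lower1)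
  next
    assume "split_parts u v t a b" then show ?thesis
      by (rule split_parts_mono) (auto intro: lterm_le.meet_lower2)
  qed
  have "lterm_le (LMeet s t) u \<or> lterm_le (LMeet s t) v \<or> lterm_le s (LJoin u v) \<or> lterm_le t (LJoin u v)"
    using LMeet.prems by (rule whitman_condition)
  then show ?case
    using LMeet.IH LMeet_leI1 LMeet_leI2 split by blast
next
  case (LJoin s t)
  have le: "lterm_le s (LJoin u v)" "lterm_le t (LJoin u v)"
    using LJoin.prems by (simp_all add: LJoin_le_iff)
  consider
      "lterm_le s u" "lterm_le t u" | "lterm_le s v" "lterm_le t v"
    | "lterm_le s u" "lterm_le t v" | "lterm_le s v" "lterm_le t u"
    | a b where "split_parts u v s a b" "lterm_le t u" | a b where "split_parts u v s a b" "lterm_le t v"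
    | a b where "lterm_le s u" "split_parts u v t a b" | a b where "lterm_le s v" "split_parts u v t a b"
    | a b c d where "split_parts u v s a b" "split_parts u v t c d"
    using LJoin.IH(1)[OF le(1)] LJoin.IH(2)[OF le(2)] by blast
  then show ?case
  proof cases
    case 1 then show ?thesis by (simp add: LJoin_le_iff)
  next
    case 2 then show ?thesis by (simp add: LJoin_le_iff)
  next
    case 3 then have "split_parts u v (LJoin s t) s t" 
      unfolding split_parts_def by (simp add: lterm_le.refl)
    then show ?thesis by blast
  next
    case 4 then have "split_parts u v (LJoin s t) t s" 
      unfolding split_parts_def by (simp add: LJoin_le_iff le_LJoinI1 le_LJoinI2 lterm_le.refl)
    then show ?thesis by blast
  next
    case (5 a b)
    have "lterm_le (LJoin s t) (LJoin (LJoin a b) t)"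
      using 5 by (intro LJoin_mono) (simp_all add: split_parts_def lterm_le.refl)
    from lterm_le.trans[OF this LJoin_swap_right] have "split_parts u v (LJoin s t) (LJoin a t) b"
      using 5 by (intro split_partsI) (auto simp: split_parts_def LJoin_le_iff)
    then show ?thesis by blast
  next
    case (6 a b)
    have "lterm_le (LJoin s t) (LJoin (LJoin a b) t)"
      using 6 by (intro LJoin_mono) (simp_all add: split_parts_def lterm_le.refl)
    from lterm_le.trans[OF this LJoin_assoc_right] have "split_parts u v (LJoin s t) a (LJoin b t)"
      using 6 by (intro split_partsI) (auto simp: split_parts_def LJoin_le_iff)
    then show ?thesis by blast
  next
    case (7 a b)
    have "lterm_le (LJoin s t) (LJoin s (LJoin a b))"
      using 7 by (intro LJoin_mono) (simp_all add: split_parts_def lterm_le.refl)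
    from lterm_le.trans[OF this LJoin_assoc_left] have "split_parts u v (LJoin s t) (LJoin s a) b"
      using 7 by (intro split_partsI) (auto simp: split_parts_def LJoin_le_iff)
    then show ?thesis by blast
  next
    case (8 a b)
    have "lterm_le (LJoin s t) (LJoin s (LJoin a b))"
      using 8 by (intro LJoin_mono) (simp_all add: split_parts_def lterm_le.refl)
    from lterm_le.trans[OF this LJoin_swap_left] have "split_parts u v (LJoin s t) a (LJoin s b)"
      using 8 by (intro split_partsI) (auto simp: split_parts_def LJoin_le_iff)
    then show ?thesis by blast
  next
    case (9 a b c d)
    have "lterm_le (LJoin s t) (LJoin (LJoin a b) (LJoin c d))"
      using 9 by (intro LJoin_mono) (simp_all add: split_parts_def)
    from lterm_le.trans[OF this LJoin_interchange] have "split_parts u v (LJoin s t) (LJoin a c) (LJoin b d)"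
      using 9 by (intro split_partsI) (auto simp: split_parts_def LJoin_le_iff)
    then show ?thesis by blast
  qed
qed

section \<open>Free lattices and lattice homomorphisms\<close>

lemma is_lub_pair:
  "x \<in> carrier L \<Longrightarrow> y \<in> carrier L \<Longrightarrow> is_lub L s {x, y} \<longleftrightarrow>
     s \<in> carrier L \<and> x \<sqsubseteq>\<^bsub>L\<^esub> s \<and> y \<sqsubseteq>\<^bsub>L\<^esub> s \<and>
     (\<forall>u\<in>carrier L. x \<sqsubseteq>\<^bsub>L\<^esub> u \<longrightarrow> y \<sqsubseteq>\<^bsub>L\<^esub> u \<longrightarrow> s \<sqsubseteq>\<^bsub>L\<^esub> u)"
  by (auto simp: least_def Upper_def)

lemma is_glb_pair:
  "x \<in> carrier L \<Longrightarrow> y \<in> carrier L \<Longrightarrow> is_glb L s {x, y} \<longleftrightarrow>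
     s \<in> carrier L \<and> s \<sqsubseteq>\<^bsub>L\<^esub> x \<and> s \<sqsubseteq>\<^bsub>L\<^esub> y \<and>
     (\<forall>u\<in>carrier L. u \<sqsubseteq>\<^bsub>L\<^esub> x \<longrightarrow> u \<sqsubseteq>\<^bsub>L\<^esub> y \<longrightarrow> u \<sqsubseteq>\<^bsub>L\<^esub> s)"
  by (auto simp: greatest_def Lower_def)

lemma (in partial_order) join_eqI: "is_lub L s {x, y} \<Longrightarrow> x \<squnion> y = s"
  unfolding join_def sup_def by (rule some_equality) (auto intro: least_unique)

lemma (in partial_order) meet_eqI: "is_glb L s {x, y} \<Longrightarrow> x \<sqinter> y = s"
  unfolding meet_def inf_def by (rule some_equality) (auto intro: greatest_unique)

lemma lattice_if_lubs_glbs: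
  assumes "partial_order L"
    and "\<And>x y. x \<in> carrier L \<Longrightarrow> y \<in> carrier L \<Longrightarrow> \<exists>s. is_lub L s {x, y}"
    and "\<And>x y. x \<in> carrier L \<Longrightarrow> y \<in> carrier L \<Longrightarrow> \<exists>s. is_glb L s {x, y}"
  shows "lattice L"
  using assms
  by (simp add: lattice_def upper_semilattice_def lower_semilattice_def
      upper_semilattice_axioms_def lower_semilattice_axioms_def)

definition term_class :: "'x set \<Rightarrow> 'x lterm \<Rightarrow> 'x lterm set" where
  "term_class X t = lterm_equiv X `` {t}"

lemma carrier_free_lattice: "carrier (free_lattice X) = term_class X ` {t. lvars t \<subseteq> X}"
  unfolding free_lattice_def term_class_def quotient_def by auto

lemma term_class_in_carrier: "lvars t \<subseteq> X \<Longrightarrow> term_class X t \<in> carrier (free_lattice X)"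
  unfolding carrier_free_lattice by simp

lemma mem_term_class:
  "lvars t \<subseteq> X \<Longrightarrow> s \<in> term_class X t \<longleftrightarrow> lvars s \<subseteq> X \<and> lterm_le s t \<and> lterm_le t s"
  unfolding term_class_def lterm_equiv_def by auto

lemma le_free_lattice:
  assumes "lvars s \<subseteq> X" "lvars t \<subseteq> X"
  shows "term_class X s \<sqsubseteq>\<^bsub>free_lattice X\<^esub> term_class X t \<longleftrightarrow> lterm_le s t"
proof
  assume "term_class X s \<sqsubseteq>\<^bsub>free_lattice X\<^esub> term_class X t"
  then obtain s' t' where "s' \<in> term_class X s" "t' \<in> term_class X t" "lterm_le s' t'"
    unfolding free_lattice_def by auto
  then have "lterm_le s s'" "lterm_le s' t'" "lterm_le t' t"
    using assms by (simp_all add: mem_term_class)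
  then show "lterm_le s t" by (rule lterm_le.trans[OF lterm_le.trans])
next
  assume "lterm_le s t"
  moreover have "s \<in> term_class X s" "t \<in> term_class X t"
    using assms by (simp_all add: mem_term_class lterm_le.refl)
  ultimately show "term_class X s \<sqsubseteq>\<^bsub>free_lattice X\<^esub> term_class X t"
    unfolding free_lattice_def by auto
qed

lemma term_class_eqI:
  assumes "lvars s \<subseteq> X" "lvars t \<subseteq> X" "lterm_le s t" "lterm_le t s"
  shows "term_class X s = term_class X t"
proof (rule Set.set_eqI)
  fix r
  show "r \<in> term_class X s \<longleftrightarrow> r \<in> term_class X t"
    using assms lterm_le.trans[of r s t] lterm_le.trans[of t s r]
      lterm_le.trans[of r t s] lterm_le.trans[of s t r]
    by (auto simp: mem_term_class)
qed

lemma partial_order_free_lattice: "partial_order (free_lattice X)"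
proof
  fix x y z assume "x \<in> carrier (free_lattice X)" "y \<in> carrier (free_lattice X)"
    "z \<in> carrier (free_lattice X)" "x \<sqsubseteq>\<^bsub>free_lattice X\<^esub> y" "y \<sqsubseteq>\<^bsub>free_lattice X\<^esub> z"
  then show "x \<sqsubseteq>\<^bsub>free_lattice X\<^esub> z"
    by (auto simp: carrier_free_lattice le_free_lattice intro: lterm_le.trans)
next
  fix x y assume xy: "x \<in> carrier (free_lattice X)" "y \<in> carrier (free_lattice X)"
    "x \<sqsubseteq>\<^bsub>free_lattice X\<^esub> y" "y \<sqsubseteq>\<^bsub>free_lattice X\<^esub> x"
  from xy(1) obtain s where s: "x = term_class X s" "lvars s \<subseteq> X"
    by (auto simp: carrier_free_lattice)
  from xy(2) obtain t where t: "y = term_class X t" "lvars t \<subseteq> X"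
    by (auto simp: carrier_free_lattice)
  have "x = y"
    using xy(3,4) s t term_class_eqI[of s X t] by (simp add: le_free_lattice)
  then show "x .=\<^bsub>free_lattice X\<^esub> y" by (simp add: free_lattice_def)
qed (auto simp: free_lattice_def term_class_def quotient_def lterm_equiv_def Image_def
      intro: lterm_le.refl)

lemma is_lub_free_lattice:
  assumes "lvars s \<subseteq> X" "lvars t \<subseteq> X"
  shows "is_lub (free_lattice X) (term_class X (LJoin s t)) {term_class X s, term_class X t}"
  using assms
  by (subst is_lub_pair)
    (auto simp: carrier_free_lattice le_free_lattice LJoin_le_iff lterm_le.join_upper1 lterm_le.join_upper2)

lemma is_glb_free_lattice:
  assumes "lvars s \<subseteq> X" "lvars t \<subseteq> X"
  shows "is_glb (free_lattice X) (term_class X (LMeet s t)) {term_class X s, term_class X t}"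
  using assms
  by (subst is_glb_pair)
    (auto simp: carrier_free_lattice le_free_lattice le_LMeet_iff lterm_le.meet_lower1 lterm_le.meet_lower2)

lemma lattice_free_lattice: "lattice (free_lattice X)"
proof (rule lattice_if_lubs_glbs[OF partial_order_free_lattice])
  fix x y assume "x \<in> carrier (free_lattice X)" "y \<in> carrier (free_lattice X)"
  then obtain s t where "x = term_class X s" "y = term_class X t" "lvars s \<subseteq> X" "lvars t \<subseteq> X"
    by (auto simp: carrier_free_lattice)
  then show "\<exists>z. is_lub (free_lattice X) z {x, y}" "\<exists>z. is_glb (free_lattice X) z {x, y}"
    using is_lub_free_lattice is_glb_free_lattice by blast+
qed

lemma join_free_lattice:
  "lvars s \<subseteq> X \<Longrightarrow> lvars t \<subseteq> X \<Longrightarrow>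
    term_class X s \<squnion>\<^bsub>free_lattice X\<^esub> term_class X t = term_class X (LJoin s t)"
  by (rule partial_order.join_eqI[OF partial_order_free_lattice is_lub_free_lattice])

lemma meet_free_lattice:
  "lvars s \<subseteq> X \<Longrightarrow> lvars t \<subseteq> X \<Longrightarrow>
    term_class X s \<sqinter>\<^bsub>free_lattice X\<^esub> term_class X t = term_class X (LMeet s t)"
  by (rule partial_order.meet_eqI[OF partial_order_free_lattice is_glb_free_lattice])

section \<open>A rank on finite lower bounded lattices\<close>

text \<open>
  Let \<open>w p\<close> be the least size of a term that represents the least preimage of \<open>p\<close>. Given
  \<open>p \<sqsubseteq> a \<squnion> b\<close>, shrink \<open>a\<close> and \<open>b\<close> to a minimal such pair \<open>(a', b')\<close>. A shortest term for \<open>p\<close> lies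
  below the join of terms for \<open>a'\<close> and \<open>b'\<close>, hence splits into two shorter terms. The values of these
  form again such a pair, so by minimality they equal \<open>a'\<close> and \<open>b'\<close>; being below the least preimages,
  the two shorter terms represent them.
\<close>

lemma lower_bounded_split_rank:
  fixes L (structure)
  assumes "lattice L" and fin: "finite (carrier L)" and "lower_bounded_lattice L"
  obtains w :: "'l \<Rightarrow> nat" where
    "\<And>p a b. p \<in> carrier L \<Longrightarrow> a \<in> carrier L \<Longrightarrow> b \<in> carrier L \<Longrightarrow>
       p \<sqsubseteq> a \<squnion> b \<Longrightarrow> \<not> p \<sqsubseteq> a \<Longrightarrow> \<not> p \<sqsubseteq> b \<Longrightarrow>
       \<exists>a'\<in>carrier L. \<exists>b'\<in>carrier L.
         a' \<sqsubseteq> a \<and> b' \<sqsubseteq> b \<and> p \<sqsubseteq> a' \<squnion> b' \<and> w a' < w p \<and> w b' < w p"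
proof -
  interpret lattice L by fact
  obtain k :: nat and h where lb: "lower_bounded_hom (free_lattice {..<k}) L h"
    and surj: "h ` carrier (free_lattice {..<k}) = carrier L"
    using assms(3) unfolding lower_bounded_lattice_def by blast
  define X where "X = {..<k}"
  define ev where "ev t = h (term_class X t)" for t
  have hom: "h \<in> carrier (free_lattice X) \<rightarrow> carrier L" "join_pres (free_lattice X) L h"
    using lb unfolding lower_bounded_hom_def lattice_hom_def X_def by auto
  have ev_closed: "ev t \<in> carrier L" if "lvars t \<subseteq> X" for t
    using hom(1) term_class_in_carrier[OF that] by (auto simp: ev_def)
  have ev_join: "ev (LJoin s t) = ev s \<squnion> ev t" if "lvars s \<subseteq> X" "lvars t \<subseteq> X" for s t
    using hom(2) that unfolding join_pres_def ev_def
    by (metis join_free_lattice term_class_in_carrier)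
  have ev_mono: "ev s \<sqsubseteq> ev t" if "lvars s \<subseteq> X" "lvars t \<subseteq> X" "lterm_le s t" for s t
    unfolding ev_def using that
    by (intro use_iso2[OF join_pres_isotone[OF hom]]) (simp_all add: le_free_lattice term_class_in_carrier)
  have "carrier L = ev ` {t. lvars t \<subseteq> X}"
    using surj by (simp add: carrier_free_lattice ev_def X_def image_image)
  then have ev_surj: "\<exists>t. lvars t \<subseteq> X \<and> ev t = a" if "a \<in> carrier L" for a
    using that by auto

  \<comment> \<open>terms for the least element of the preimage of the up-set of \<open>a\<close>\<close>
  define rep where "rep a t \<longleftrightarrow> lvars t \<subseteq> X \<and> a \<sqsubseteq> ev t \<and>
      (\<forall>s. lvars s \<subseteq> X \<longrightarrow> a \<sqsubseteq> ev s \<longrightarrow> lterm_le t s)" for a t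
  have rep_ex: "\<exists>t. rep a t" if a: "a \<in> carrier L" for a
  proof -
    obtain s where "lvars s \<subseteq> X" "ev s = a" using ev_surj[OF a] by blast
    then have "term_class X s \<in> {x \<in> carrier (free_lattice X). a \<sqsubseteq> h x}"
      using a term_class_in_carrier by (auto simp: ev_def)
    then obtain m where m: "least (free_lattice X) m {x \<in> carrier (free_lattice X). a \<sqsubseteq> h x}"
      using lb a unfolding lower_bounded_hom_def X_def by blast
    then obtain t where t: "lvars t \<subseteq> X" "m = term_class X t"
      using least_mem[OF m] by (auto simp: carrier_free_lattice)
    have "lterm_le t s" if "lvars s \<subseteq> X" "a \<sqsubseteq> ev s" for s
      using least_le[OF m, of "term_class X s"] that t
      by (simp add: ev_def le_free_lattice term_class_in_carrier)
    then show ?thesis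
      using t least_mem[OF m] unfolding rep_def ev_def by blast
  qed
  have rep_eq: "ev t = a" if a: "a \<in> carrier L" and "rep a t" for a t
  proof -
    obtain s where s: "lvars s \<subseteq> X" "ev s = a" using ev_surj[OF a] by blast
    then have "ev t \<sqsubseteq> a"
      using that ev_mono[of t s] unfolding rep_def by auto
    then show ?thesis
      using that ev_closed unfolding rep_def by (auto intro: le_antisym)
  qed
  define w where "w a = (LEAST n. \<exists>t. rep a t \<and> size t = n)" for a
  have w_attained: "\<exists>t. rep a t \<and> size t = w a" if "a \<in> carrier L" for a
    unfolding w_def using LeastI_ex[of "\<lambda>n. \<exists>t. rep a t \<and> size t = n"] rep_ex[OF that] by blast
  have w_le: "w a \<le> size t" if "rep a t" for a t
    unfolding w_def using Least_le[of "\<lambda>n. \<exists>t. rep a t \<and> size t = n" "size t"] that by blast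

  show thesis
  proof (rule that[of w])
    fix p a b
    assume p: "p \<in> carrier L" and a: "a \<in> carrier L" and b: "b \<in> carrier L"
      and pab: "p \<sqsubseteq> a \<squnion> b" and pa: "\<not> p \<sqsubseteq> a" and pb: "\<not> p \<sqsubseteq> b"
    define below where "below c = {x \<in> carrier L. x \<sqsubseteq> c}" for c
    have below_mono: "below c \<subseteq> below d" if "c \<sqsubseteq> d" "c \<in> carrier L" "d \<in> carrier L" for c d
      using that le_trans unfolding below_def by blast
    have fin_below: "finite (below c)" for c
      unfolding below_def using fin by simp
    \<comment> \<open>minimality of a pair is measured by the number of elements below its components\<close>
    define P where "P = {(c, d). c \<in> carrier L \<and> d \<in> carrier L \<and> c \<sqsubseteq> a \<and> d \<sqsubseteq> b \<and> p \<sqsubseteq> c \<squnion> d}"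
    have "(a, b) \<in> P" using a b pab by (simp add: P_def)
    then obtain a' b' where P: "(a', b') \<in> P"
      and min: "\<And>c d. (c, d) \<in> P \<Longrightarrow>
        card (below a') + card (below b') \<le> card (below c) + card (below d)"
      using ex_has_least_nat[of "\<lambda>x. x \<in> P" "(a, b)" "\<lambda>(c, d). card (below c) + card (below d)"]
      by auto
    then have a': "a' \<in> carrier L" "a' \<sqsubseteq> a" and b': "b' \<in> carrier L" "b' \<sqsubseteq> b"
      and pab': "p \<sqsubseteq> a' \<squnion> b'"
      by (auto simp: P_def)
    obtain t where t: "rep p t" "size t = w p" using w_attained[OF p] by blast
    obtain u where u: "rep a' u" using rep_ex[OF a'(1)] by blast
    obtain v where v: "rep b' v" using rep_ex[OF b'(1)] by blast
    have vars: "lvars t \<subseteq> X" "lvars u \<subseteq> X" "lvars v \<subseteq> X"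
      using t u v by (auto simp: rep_def)
    have ev: "ev t = p" "ev u = a'" "ev v = b'"
      using rep_eq t u v p a' b' by auto
    have "lterm_le t (LJoin u v)"
      using t(1) pab' vars unfolding rep_def by (auto simp: ev_join ev)
    moreover have "\<not> lterm_le t u" "\<not> lterm_le t v"
      using ev_mono[of t u] ev_mono[of t v] vars ev pa pb a b a' b' p le_trans by metis+
    ultimately obtain c d where cd: "split_parts u v t c d"
      using split_below_join by metis
    then have vars': "lvars c \<subseteq> X" "lvars d \<subseteq> X"
      using vars unfolding split_parts_def by auto
    with cd have le: "ev c \<sqsubseteq> a'" "ev d \<sqsubseteq> b'"
      and "p \<sqsubseteq> ev c \<squnion> ev d"
      using vars ev ev_mono[of c u] ev_mono[of d v] ev_mono[of t "LJoin c d"] ev_join[of c d]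
      unfolding split_parts_def by auto
    then have "(ev c, ev d) \<in> P"
      unfolding P_def
      using ev_closed vars' a b a' b' le_trans[OF le(1) a'(2)] le_trans[OF le(2) b'(2)] by simp
    from min[OF this] have "below a' \<subseteq> below (ev c)" "below b' \<subseteq> below (ev d)"
      using card_seteq[OF fin_below below_mono[OF le(1)]] card_seteq[OF fin_below below_mono[OF le(2)]]
        card_mono[OF fin_below below_mono[OF le(1)]] card_mono[OF fin_below below_mono[OF le(2)]]
        ev_closed vars' a' b' by force+
    then have "a' \<sqsubseteq> ev c" "b' \<sqsubseteq> ev d"
      using a' b' by (auto simp: below_def)
    moreover have "lterm_le c u" "lterm_le d v"
      using cd by (auto simp: split_parts_def)
    ultimately have "rep a' c" "rep b' d"
      using u v vars' lterm_le.trans[of c u] lterm_le.trans[of d v] unfolding rep_def by auto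
    then have "w a' \<le> size c" "w b' \<le> size d"
      using w_le by auto
    moreover have "size c < w p" "size d < w p"
      using cd t(2) by (simp_all add: split_parts_def)
    ultimately show "\<exists>a'\<in>carrier L. \<exists>b'\<in>carrier L.
         a' \<sqsubseteq> a \<and> b' \<sqsubseteq> b \<and> p \<sqsubseteq> a' \<squnion> b' \<and> w a' < w p \<and> w b' < w p"
      using a' b' pab' by (intro bexI[of _ a'] bexI[of _ b']) auto
  qed
qed

section \<open>A ranked criterion for lower boundedness\<close>

primrec term_value :: "('l, 'm) gorder_scheme \<Rightarrow> ('x \<Rightarrow> 'l) \<Rightarrow> 'x lterm \<Rightarrow> 'l" where
  "term_value M v (LVar x) = v x"
| "term_value M v (LJoin s t) = term_value M v s \<squnion>\<^bsub>M\<^esub> term_value M v t"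
| "term_value M v (LMeet s t) = term_value M v s \<sqinter>\<^bsub>M\<^esub> term_value M v t"

lemma (in lattice) term_value_closed:
  "v ` X \<subseteq> carrier L \<Longrightarrow> lvars t \<subseteq> X \<Longrightarrow> term_value L v t \<in> carrier L"
  by (induction t) auto

lemma (in lattice) join_le_iff:
  "x \<in> carrier L \<Longrightarrow> y \<in> carrier L \<Longrightarrow> z \<in> carrier L \<Longrightarrow> x \<squnion> y \<sqsubseteq> z \<longleftrightarrow> x \<sqsubseteq> z \<and> y \<sqsubseteq> z"
  by (meson join_closed join_le join_left join_right le_trans)

lemma (in lattice) le_meet_iff:
  "x \<in> carrier L \<Longrightarrow> y \<in> carrier L \<Longrightarrow> z \<in> carrier L \<Longrightarrow> z \<sqsubseteq> x \<sqinter> y \<longleftrightarrow> z \<sqsubseteq> x \<and> z \<sqsubseteq> y"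
  by (meson meet_closed meet_le meet_left meet_right le_trans)

lemma (in lattice) term_value_mono:
  assumes "lterm_le s t" and v: "\<And>x. v x \<in> carrier L"
  shows "term_value L v s \<sqsubseteq> term_value L v t"
proof -
  have closed: "term_value L v t \<in> carrier L" for t
    by (rule term_value_closed[of v UNIV]) (auto simp: v)
  from assms(1) show ?thesis
    by induction (auto simp: closed join_le_iff le_meet_iff join_left join_right meet_left meet_right
        intro: le_trans[OF _ _ closed closed closed])
qed

lemma finite_term_join:
  assumes "finite T" "T \<noteq> {}" "\<And>t. t \<in> T \<Longrightarrow> lvars t \<subseteq> X"
  obtains j where "lvars j \<subseteq> X" "\<And>s. lterm_le j s \<longleftrightarrow> (\<forall>t\<in>T. lterm_le t s)"
proof -
  have "\<exists>j. lvars j \<subseteq> X \<and> (\<forall>s. lterm_le j s \<longleftrightarrow> (\<forall>t\<in>T. lterm_le t s))"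
    using assms
  proof (induction T rule: finite_ne_induct)
    case (singleton t)
    then show ?case by (intro exI[of _ t]) simp
  next
    case (insert t T)
    then obtain j where "lvars j \<subseteq> X" "\<forall>s. lterm_le j s \<longleftrightarrow> (\<forall>t\<in>T. lterm_le t s)"
      by auto
    then show ?case
      using insert.prems by (intro exI[of _ "LJoin t j"]) (simp add: LJoin_le_iff)
  qed
  then show thesis using that by blast
qed

lemma (in lattice) finite_term_meet:
  assumes "finite T" "T \<noteq> {}" "\<forall>t\<in>T. lvars t \<subseteq> X" and v: "v ` X \<subseteq> carrier L"
  shows "\<exists>m. lvars m \<subseteq> X \<and> (\<forall>s. lterm_le s m \<longleftrightarrow> (\<forall>t\<in>T. lterm_le s t)) \<and>
      (\<forall>a\<in>carrier L. a \<sqsubseteq> term_value L v m \<longleftrightarrow> (\<forall>t\<in>T. a \<sqsubseteq> term_value L v t))"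
  using assms(1-3)
proof (induction T rule: finite_ne_induct)
  case (singleton t)
  then show ?case by (intro exI[of _ t]) simp
next
  case (insert t T)
  then obtain m where "lvars m \<subseteq> X" "\<forall>s. lterm_le s m \<longleftrightarrow> (\<forall>t\<in>T. lterm_le s t)"
    "\<forall>a\<in>carrier L. a \<sqsubseteq> term_value L v m \<longleftrightarrow> (\<forall>t\<in>T. a \<sqsubseteq> term_value L v t)"
    by auto
  then show ?case
    using insert.prems term_value_closed[OF v]
    by (intro exI[of _ "LMeet t m"]) (simp add: le_LMeet_iff le_meet_iff)
qed

text \<open>
  The elements of \<open>P\<close> play the role of the join irreducible elements, and \<open>d\<close> bounds the length of
  chains of the relation \<open>D\<close> on them. The free lattice is taken on all elements of \<open>M\<close>. The least
  preimage of the up-set of \<open>p\<close> is, by recursion on \<open>d\<close>, the meet of all generators above \<open>p\<close> and of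
  all joins of least preimages over low-rank covers of \<open>p\<close>; for general elements one takes joins over
  \<open>P\<close>. Minimality of this term is proved by induction on the competing term, where the covering
  hypothesis deals with joins.
\<close>

lemma lower_bounded_if_ranked:
  fixes M (structure)
  assumes "lattice M" and fin: "finite (carrier M)" and P: "P \<subseteq> carrier M"
    and bot: "\<And>a. a \<in> carrier M \<Longrightarrow> \<exists>p\<in>P. p \<sqsubseteq> a"
    and dense: "\<And>a b. a \<in> carrier M \<Longrightarrow> b \<in> carrier M \<Longrightarrow> (\<And>p. p \<in> P \<Longrightarrow> p \<sqsubseteq> a \<Longrightarrow> p \<sqsubseteq> b) \<Longrightarrow> a \<sqsubseteq> b"
    and cover: "\<And>p a b. p \<in> P \<Longrightarrow> a \<in> carrier M \<Longrightarrow> b \<in> carrier M \<Longrightarrow>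
       p \<sqsubseteq> a \<squnion> b \<Longrightarrow> \<not> p \<sqsubseteq> a \<Longrightarrow> \<not> p \<sqsubseteq> b \<Longrightarrow>
       \<exists>E\<subseteq>P. E \<noteq> {} \<and> (\<forall>q\<in>E. (q \<sqsubseteq> a \<or> q \<sqsubseteq> b) \<and> d q < (d p :: nat)) \<and>
         (\<forall>u\<in>carrier M. (\<forall>q\<in>E. q \<sqsubseteq> u) \<longrightarrow> p \<sqsubseteq> u)"
  shows "lower_bounded_lattice M"
proof -
  interpret lattice M by fact
  obtain gen where gen: "bij_betw gen {..<card (carrier M)} (carrier M)"
    using ex_bij_betw_nat_finite[OF fin] by (auto simp: atLeast0LessThan)
  define X where "X = {..<card (carrier M)}"
  have gen_X: "gen ` X = carrier M"
    using gen by (simp add: X_def bij_betw_def)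
  then have gen_sub: "gen ` X \<subseteq> carrier M" by simp
  define ev where "ev = term_value M gen"
  have ev_closed: "ev t \<in> carrier M" if "lvars t \<subseteq> X" for t
    unfolding ev_def using gen_sub that by (rule term_value_closed)
  have ev_join: "ev (LJoin s t) = ev s \<squnion> ev t" and ev_meet: "ev (LMeet s t) = ev s \<sqinter> ev t" for s t
    by (simp_all add: ev_def)
  have ev_mono: "ev s \<sqsubseteq> ev t" if st: "lvars s \<subseteq> X" "lvars t \<subseteq> X" "lterm_le s t" for s t
  proof -
    have ne: "carrier M \<noteq> {}" using ev_closed st by blast
    \<comment> \<open>the valuation is extended arbitrarily, since inequalities between terms may pass
      through other variables\<close>
    define v where "v x = (if x \<in> X then gen x else (SOME a. a \<in> carrier M))" for x
    have v: "v x \<in> carrier M" for x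
      using gen_X ne by (auto simp: v_def some_in_eq)
    have "lvars t \<subseteq> X \<Longrightarrow> term_value M v t = ev t" for t
      by (induction t) (auto simp: ev_def v_def)
    then show ?thesis
      using term_value_mono[OF st(3), of v] v st by simp
  qed

  define rep where "rep a t \<longleftrightarrow> lvars t \<subseteq> X \<and> a \<sqsubseteq> ev t \<and>
      (\<forall>s. lvars s \<subseteq> X \<longrightarrow> a \<sqsubseteq> ev s \<longrightarrow> lterm_le t s)" for a t
  have rep_P: "\<exists>t. rep p t" if "p \<in> P" for p
    using that
  proof (induction "d p" arbitrary: p rule: less_induct)
    case less
    define Q where "Q = {q \<in> P. d q < d p}"
    have "\<forall>q\<in>Q. \<exists>t. rep q t" using less.hyps by (auto simp: Q_def)
    then obtain \<beta> where \<beta>: "\<And>q. q \<in> Q \<Longrightarrow> rep q (\<beta> q)" by metis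
    have finQ: "finite Q" by (rule finite_subset[OF _ fin]) (use P in \<open>auto simp: Q_def\<close>)
    define covers where "covers = {E. E \<subseteq> Q \<and> E \<noteq> {} \<and>
        (\<forall>u\<in>carrier M. (\<forall>q\<in>E. q \<sqsubseteq> u) \<longrightarrow> p \<sqsubseteq> u)}"
    have "\<exists>j. lvars j \<subseteq> X \<and> (\<forall>s. lterm_le j s \<longleftrightarrow> (\<forall>q\<in>E. lterm_le (\<beta> q) s))" if "E \<in> covers" for E
    proof -
      have E: "finite E" "E \<noteq> {}" "E \<subseteq> Q"
        using that finQ finite_subset unfolding covers_def by auto
      show ?thesis
        by (rule finite_term_join[of "\<beta> ` E" X]) (use E \<beta> in \<open>auto simp: rep_def\<close>)
    qed
    then obtain J where J: "\<And>E. E \<in> covers \<Longrightarrow> lvars (J E) \<subseteq> X"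
        "\<And>E s. E \<in> covers \<Longrightarrow> lterm_le (J E) s \<longleftrightarrow> (\<forall>q\<in>E. lterm_le (\<beta> q) s)"
      by metis
    define T where "T = LVar ` {i \<in> X. p \<sqsubseteq> gen i} \<union> J ` covers"
    have p: "p \<in> carrier M" using less.prems P by auto
    have "finite T"
      unfolding T_def covers_def X_def using finQ by simp
    moreover have "T \<noteq> {}"
    proof -
      have "p \<in> gen ` X" using p gen_X by simp
      then obtain i where "i \<in> X" "gen i = p" by auto
      then show ?thesis using p by (auto simp: T_def)
    qed
    moreover have T_vars: "lvars t \<subseteq> X" if "t \<in> T" for t
      using that J by (auto simp: T_def)
    ultimately have "\<exists>m. lvars m \<subseteq> X \<and> (\<forall>s. lterm_le s m \<longleftrightarrow> (\<forall>t\<in>T. lterm_le s t)) \<and>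
        (\<forall>a\<in>carrier M. a \<sqsubseteq> ev m \<longleftrightarrow> (\<forall>t\<in>T. a \<sqsubseteq> ev t))"
      unfolding ev_def using gen_sub by (intro finite_term_meet) simp_all
    then obtain m where m: "lvars m \<subseteq> X" "\<And>s. lterm_le s m \<longleftrightarrow> (\<forall>t\<in>T. lterm_le s t)"
      "\<And>a. a \<in> carrier M \<Longrightarrow> a \<sqsubseteq> ev m \<longleftrightarrow> (\<forall>t\<in>T. a \<sqsubseteq> ev t)"
      by auto
    have m_le: "lterm_le m t" if "t \<in> T" for t
      using m(2)[of m] that lterm_le.refl by blast
    have "p \<sqsubseteq> ev (J E)" if E: "E \<in> covers" for E
    proof -
      have "q \<sqsubseteq> ev (J E)" if q: "q \<in> E" for q
      proof -
        have "q \<in> Q" using E q by (auto simp: covers_def)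
        moreover have "lterm_le (\<beta> q) (J E)"
          using J(2)[OF E, of "J E"] q lterm_le.refl by blast
        ultimately show ?thesis
          using \<beta>[of q] ev_mono[of "\<beta> q" "J E"] J(1)[OF E] ev_closed P le_trans[of q "ev (\<beta> q)" "ev (J E)"]
          unfolding rep_def Q_def by auto
      qed
      then show ?thesis
        using E ev_closed[OF J(1)[OF E]] by (auto simp: covers_def)
    qed
    then have "p \<sqsubseteq> ev m"
      using m(3)[OF p] by (auto simp: T_def ev_def)
    moreover have "lterm_le m t" if "lvars t \<subseteq> X" "p \<sqsubseteq> ev t" for t
      using that
    proof (induction t)
      case (LVar x)
      then show ?case by (intro m_le) (auto simp: T_def ev_def)
    next
      case (LMeet s t)
      then show ?case
        using ev_closed[of s] ev_closed[of t] p by (auto simp: le_LMeet_iff ev_def le_meet_iff)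
    next
      case (LJoin s t)
      have vars: "lvars s \<subseteq> X" "lvars t \<subseteq> X" using LJoin.prems by auto
      consider "p \<sqsubseteq> ev s" | "p \<sqsubseteq> ev t" | "\<not> p \<sqsubseteq> ev s" "\<not> p \<sqsubseteq> ev t" by blast
      then show ?case
      proof cases
        case 1 then show ?thesis using LJoin.IH(1) vars le_LJoinI1 by simp
      next
        case 2 then show ?thesis using LJoin.IH(2) vars le_LJoinI2 by simp
      next
        case 3
        have "p \<sqsubseteq> ev s \<squnion> ev t" using LJoin.prems by (simp add: ev_def)
        from cover[OF less.prems ev_closed[OF vars(1)] ev_closed[OF vars(2)] this 3]
        obtain E where E: "E \<subseteq> P" "E \<noteq> {}"
            "\<forall>q\<in>E. (q \<sqsubseteq> ev s \<or> q \<sqsubseteq> ev t) \<and> d q < d p"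
            "\<forall>u\<in>carrier M. (\<forall>q\<in>E. q \<sqsubseteq> u) \<longrightarrow> p \<sqsubseteq> u"
          by auto
        then have cov: "E \<in> covers" "\<forall>q\<in>E. q \<in> Q" by (auto simp: covers_def Q_def)
        have "lterm_le (\<beta> q) (LJoin s t)" if q: "q \<in> E" for q
        proof -
          have "lterm_le (\<beta> q) s \<or> lterm_le (\<beta> q) t"
            using \<beta>[of q] cov(2) q E(3) vars unfolding rep_def by blast
          then show ?thesis using le_LJoinI1 le_LJoinI2 by (elim disjE)
        qed
        then have "lterm_le (J E) (LJoin s t)" using J(2)[OF cov(1)] by simp
        moreover have "lterm_le m (J E)" using m_le cov(1) by (simp add: T_def)
        ultimately show ?thesis using lterm_le.trans by metis
      qed
    qed
    ultimately show ?case using m(1) unfolding rep_def by blast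
  qed
  then obtain \<beta> where \<beta>: "\<And>p. p \<in> P \<Longrightarrow> rep p (\<beta> p)" by metis
  have rep_ex: "\<exists>t. rep a t" if a: "a \<in> carrier M" for a
  proof -
    define A where "A = {p \<in> P. p \<sqsubseteq> a}"
    have "finite A" by (rule finite_subset[OF _ fin]) (use P in \<open>auto simp: A_def\<close>)
    moreover have "A \<noteq> {}" using bot[OF a] by (auto simp: A_def)
    moreover have "lvars t \<subseteq> X" if "t \<in> \<beta> ` A" for t
      using that \<beta> by (auto simp: A_def rep_def)
    ultimately obtain j where j: "lvars j \<subseteq> X" "\<And>s. lterm_le j s \<longleftrightarrow> (\<forall>t\<in>\<beta> ` A. lterm_le t s)"
      using finite_term_join[of "\<beta> ` A" X] by auto
    have "p \<sqsubseteq> ev j" if "p \<in> P" "p \<sqsubseteq> a" for p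
    proof -
      have "lterm_le (\<beta> p) j" using j(2)[of j] that lterm_le.refl by (auto simp: A_def)
      then show ?thesis
        using \<beta>[of p] that ev_mono[of "\<beta> p" j] j(1) ev_closed P le_trans[of p "ev (\<beta> p)" "ev j"]
        unfolding rep_def by auto
    qed
    then have "a \<sqsubseteq> ev j" using dense[OF a ev_closed[OF j(1)]] by blast
    moreover have "lterm_le j s" if "lvars s \<subseteq> X" "a \<sqsubseteq> ev s" for s
      unfolding j(2) using that \<beta> a P ev_closed le_trans[of _ a "ev s"] by (auto simp: A_def rep_def)
    ultimately show ?thesis using j(1) unfolding rep_def by blast
  qed

  define h where "h C = ev (SOME t. t \<in> C)" for C
  have h: "h (term_class X t) = ev t" if t: "lvars t \<subseteq> X" for t
  proof -
    have "t \<in> term_class X t" using t by (simp add: mem_term_class lterm_le.refl)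
    then have "(SOME t'. t' \<in> term_class X t) \<in> term_class X t" by (rule someI)
    then show ?thesis
      using ev_mono ev_closed t unfolding h_def mem_term_class[OF t] by (intro le_antisym) auto
  qed
  have hom: "lattice_hom (free_lattice X) M h"
    unfolding lattice_hom_def join_pres_def meet_pres_def
    using lattice_free_lattice[of X] \<open>lattice M\<close>
    by (auto simp: carrier_free_lattice h ev_closed join_free_lattice meet_free_lattice ev_join ev_meet)
  have "\<exists>m. least (free_lattice X) m {x \<in> carrier (free_lattice X). a \<sqsubseteq> h x}" if a: "a \<in> carrier M" for a
  proof -
    obtain t where "rep a t" using rep_ex[OF a] by blast
    then have "least (free_lattice X) (term_class X t) {x \<in> carrier (free_lattice X). a \<sqsubseteq> h x}"
      unfolding least_def rep_def by (auto simp: carrier_free_lattice h le_free_lattice)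
    then show ?thesis ..
  qed
  moreover have "h ` carrier (free_lattice X) = carrier M"
  proof (intro equalityI subsetI)
    fix a assume "a \<in> carrier M"
    then have "a \<in> gen ` X" using gen_X by simp
    then obtain i where "i \<in> X" "gen i = a" by auto
    then show "a \<in> h ` carrier (free_lattice X)"
      using h[of "LVar i"] term_class_in_carrier[of "LVar i" X] by (intro image_eqI[of _ _ "term_class X (LVar i)"]) (auto simp: ev_def)
  qed (auto simp: carrier_free_lattice h ev_closed)
  ultimately show ?thesis
    using hom unfolding lower_bounded_lattice_def lower_bounded_hom_def X_def by blast
qed

section \<open>Convex combinations over a totally ordered division ring\<close>

lemma zero_less_one_division_ring: "0 < (1::'a::{division_ring, linordered_ring_strict})"
  using zero_le_square[of "1::'a"] by (simp add: order_less_le)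

lemma inverse_positive_division_ring:
  fixes a :: "'a::{division_ring, linordered_ring_strict}"
  assumes "0 < a"
  shows "0 < inverse a"
proof (rule ccontr)
  assume "\<not> 0 < inverse a"
  then have "a * inverse a \<le> 0"
    using assms by (intro mult_nonneg_nonpos) auto
  moreover have "a * inverse a = 1"
    using assms by (intro right_inverse) auto
  ultimately show False
    using zero_less_one_division_ring[where 'a = 'a] by auto
qed

text \<open>
  The total weight \<open>t\<close> is kept as a parameter, so that weights can be moved between parts of
  a combination without rescaling.
\<close>

definition combination ::
    "(nat \<Rightarrow> 'a::{division_ring, linordered_ring_strict}) set \<Rightarrow> 'a \<Rightarrow> (nat \<Rightarrow> 'a) \<Rightarrow> bool" where
  "combination A t x \<longleftrightarrow>
     (\<exists>c. (\<forall>a\<in>A. 0 \<le> c a) \<and> sum c A = t \<and> x = (\<lambda>i. \<Sum>a\<in>A. c a * a i))"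

lemma combination_add:
  assumes "combination A s x" "combination A t y"
  shows "combination A (s + t) (\<lambda>i. x i + y i)"
proof -
  from assms obtain c d where "\<forall>a\<in>A. 0 \<le> c a" "sum c A = s" "x = (\<lambda>i. \<Sum>a\<in>A. c a * a i)"
    "\<forall>a\<in>A. 0 \<le> d a" "sum d A = t" "y = (\<lambda>i. \<Sum>a\<in>A. d a * a i)"
    unfolding combination_def by auto
  then show ?thesis unfolding combination_def
    by (intro exI[of _ "\<lambda>a. c a + d a"]) (simp add: sum.distrib distrib_right)
qed

lemma combination_scale:
  assumes "combination A t x" "0 \<le> s"
  shows "combination A (s * t) (\<lambda>i. s * x i)"
proof -
  from assms(1) obtain c where "\<forall>a\<in>A. 0 \<le> c a" "sum c A = t" "x = (\<lambda>i. \<Sum>a\<in>A. c a * a i)"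
    unfolding combination_def by auto
  with assms(2) show ?thesis unfolding combination_def
    by (intro exI[of _ "\<lambda>a. s * c a"]) (auto simp: sum_distrib_left mult.assoc)
qed

lemma combination_mono:
  assumes "combination A t x" "A \<subseteq> B" "finite B"
  shows "combination B t x"
proof -
  from assms(1) obtain c where "\<forall>a\<in>A. 0 \<le> c a" "sum c A = t" "x = (\<lambda>i. \<Sum>a\<in>A. c a * a i)"
    unfolding combination_def by auto
  then show ?thesis unfolding combination_def
    using assms(2,3)
    by (intro exI[of _ "\<lambda>a. if a \<in> A then c a else 0"])
      (auto simp: sum.If_cases if_distrib[of "\<lambda>z. z * _"] Int_absorb1 cong: if_cong)
qed

lemma combination_point:
  assumes "a \<in> A" "finite A" "0 \<le> t"
  shows "combination A t (\<lambda>i. t * a i)"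
  by (rule combination_mono[of "{a}"]) (use assms in \<open>auto simp: combination_def intro: exI[of _ "\<lambda>_. t"]\<close>)

lemma combination_nonneg: "combination A t x \<Longrightarrow> 0 \<le> t"
  unfolding combination_def by (auto intro: sum_nonneg)

lemma combination_0: "combination A 0 x \<Longrightarrow> finite A \<Longrightarrow> x = (\<lambda>i. 0)"
  unfolding combination_def by (auto simp: sum_nonneg_eq_0_iff)

lemma combination_insert:
  assumes "combination (insert v A) t x" "v \<notin> A" "finite A"
  obtains r where "0 \<le> r" "combination A (t - r) (\<lambda>i. x i - r * v i)"
proof -
  from assms(1) obtain c where c: "\<forall>a\<in>insert v A. 0 \<le> c a" "sum c (insert v A) = t"
    "x = (\<lambda>i. \<Sum>a\<in>insert v A. c a * a i)"
    unfolding combination_def by auto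
  show thesis
    by (rule that[of "c v"]) (use c assms(2,3) in \<open>auto simp: combination_def intro!: exI[of _ c]\<close>)
qed

lemma convex_set_hull: "convex_set (convex_hull_of X)"
  by (rule hull_in) (auto simp: convex_set_def)

lemma combination_in_convex:
  assumes "finite A" "A \<subseteq> C" "convex_set C" "combination A 1 x"
  shows "x \<in> C"
  using assms
proof (induction A arbitrary: x rule: finite_induct)
  case empty
  then show ?case by (simp add: combination_def)
next
  case (insert v A)
  obtain r where r: "0 \<le> r" "combination A (1 - r) (\<lambda>i. x i - r * v i)"
    using combination_insert[OF insert.prems(3) insert.hyps(2,1)] .
  have "v \<in> C" using insert.prems by simp
  show ?case
  proof (cases "r = 1")
    case True
    then have "(\<lambda>i. x i - v i) = (\<lambda>i. 0)"
      using combination_0 r insert.hyps(1) by fastforce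
    then have "x = v" by (simp add: fun_eq_iff)
    then show ?thesis using \<open>v \<in> C\<close> by simp
  next
    case False
    define s where "s = 1 - r"
    have "0 \<le> s" using combination_nonneg[OF r(2)] by (simp add: s_def)
    then have s: "0 < s" "s \<noteq> 0" using False by (auto simp: s_def)
    then have inv: "0 \<le> inverse s" using inverse_positive_division_ring[of s] by simp
    define y where "y = (\<lambda>i. inverse s * (x i - r * v i))"
    have "y \<in> C"
    proof (rule insert.IH)
      show "combination A 1 y"
        using combination_scale[OF r(2) inv] s by (simp add: y_def s_def)
    qed (use insert.prems in auto)
    then have "(\<lambda>i. r * v i + s * y i) \<in> C"
      using insert.prems(2) \<open>v \<in> C\<close> r(1) s unfolding convex_set_def s_def by auto
    also have "(\<lambda>i. r * v i + s * y i) = x"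
      using s by (simp add: y_def mult.assoc[symmetric])
    finally show ?thesis .
  qed
qed

lemma convex_hull_finite:
  assumes "finite A"
  shows "convex_hull_of A = {x. combination A 1 x}"
proof (rule hull_unique)
  show "A \<subseteq> {x. combination A 1 x}"
    using combination_point[of _ A 1] assms zero_less_one_division_ring[where 'a = 'a]
    by (auto simp: order_less_imp_le)
  show "convex_set {x. combination A 1 x}"
    unfolding convex_set_def
  proof (intro ballI allI impI, unfold mem_Collect_eq)
    fix x y and s t :: 'a
    assume "combination A 1 x" "combination A 1 y" "0 \<le> s" "0 \<le> t" "s + t = 1"
    then show "combination A 1 (\<lambda>i. s * x i + t * y i)"
      using combination_add[OF combination_scale[of A 1 x s] combination_scale[of A 1 y t]] by simp
  qed
  show "{x. combination A 1 x} \<subseteq> C" if "A \<subseteq> C" "convex_set C" for C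
    using combination_in_convex assms that by blast
qed

lemma hull_convex:
  "x \<in> convex_hull_of X \<Longrightarrow> y \<in> convex_hull_of X \<Longrightarrow> 0 \<le> s \<Longrightarrow> 0 \<le> t \<Longrightarrow> s + t = 1 \<Longrightarrow>
     (\<lambda>i. s * x i + t * y i) \<in> convex_hull_of X"
  using convex_set_hull[of X] unfolding convex_set_def by blast

lemma hull_subset_hull: "X \<subseteq> convex_hull_of Y \<Longrightarrow> convex_hull_of X \<subseteq> convex_hull_of Y"
  by (rule hull_minimal) (auto simp: convex_set_hull)

lemma convex_coord_space: "convex_set (coord_space n :: (nat \<Rightarrow> 'a::{division_ring, linordered_ring_strict}) set)"
  unfolding convex_set_def coord_space_def by auto

lemma hull_coord_space: "X \<subseteq> coord_space n \<Longrightarrow> convex_hull_of X \<subseteq> coord_space n"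
  by (rule hull_minimal) (auto simp: convex_coord_space)

lemma hull_nonzero_coordinate:
  assumes "x \<in> convex_hull_of X" "x i \<noteq> 0"
  shows "\<exists>y\<in>X. y i \<noteq> 0"
proof (rule ccontr)
  assume "\<not> (\<exists>y\<in>X. y i \<noteq> 0)"
  then have "convex_hull_of X \<subseteq> {y. y i = 0}"
    by (intro hull_minimal) (auto simp: convex_set_def)
  then show False using assms by auto
qed

section \<open>Adding a pair of antipodal points in a new direction\<close>

lemma midpoint_in_hull:
  fixes \<omega> :: "nat \<Rightarrow> 'a::{division_ring, linordered_ring_strict}"
  assumes "\<omega> n = 0"
  shows "\<omega> \<in> convex_hull_of {\<omega>(n := \<epsilon>), \<omega>(n := - \<epsilon>)}"
proof -
  define h where "h = inverse (1 + 1 :: 'a)"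
  have pos: "0 < (1 + 1 :: 'a)"
    by (intro add_pos_pos zero_less_one_division_ring)
  then have h: "0 < h"
    unfolding h_def by (rule inverse_positive_division_ring)
  have "h + h = (1 + 1) * h" by (simp only: distrib_right mult_1_left)
  also have "\<dots> = 1" unfolding h_def using pos by (intro right_inverse) simp
  finally have "h + h = 1" .
  note h = h this
  have "(\<lambda>i. h * (\<omega>(n := \<epsilon>)) i + h * (\<omega>(n := - \<epsilon>)) i) \<in> convex_hull_of {\<omega>(n := \<epsilon>), \<omega>(n := - \<epsilon>)}"
    using h by (intro hull_convex hull_inc) auto
  also have "(\<lambda>i. h * (\<omega>(n := \<epsilon>)) i + h * (\<omega>(n := - \<epsilon>)) i) = \<omega>"
    using h assms by (auto simp: fun_eq_iff distrib_right[symmetric])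
  finally show ?thesis .
qed

text \<open>
  If \<open>\<alpha>\<close> and \<open>\<beta>\<close> are the weights of the two new points, the new coordinate of \<open>x\<close> is
  \<open>(\<alpha> - \<beta>) * \<epsilon>\<close>. Trading \<open>\<beta>\<close> times both new points for \<open>2\<beta>\<close> times \<open>\<omega>\<close> leaves a single new point
  whose weight \<open>\<alpha> - \<beta> = x n * \<epsilon>\<close> depends on \<open>x\<close> alone, and so does the vector that the remaining
  weights on old points define. The sign \<open>\<epsilon>\<close> selects the side on which \<open>x\<close> lies.
\<close>

lemma combination_split:
  fixes \<Omega> :: "(nat \<Rightarrow> 'a::{division_ring, linordered_ring_strict}) set"
  assumes \<Omega>: "finite \<Omega>" "\<Omega> \<subseteq> coord_space n" "\<omega> \<in> \<Omega>"
    and Y: "Y \<subseteq> \<Omega> \<union> {\<omega>(n := \<epsilon>), \<omega>(n := - \<epsilon>)}" and \<epsilon>: "\<epsilon> = 1 \<or> \<epsilon> = -1"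
    and x: "combination Y 1 x" and nonneg: "0 \<le> x n * \<epsilon>"
  obtains Z where "Z = Y \<inter> \<Omega> \<or> Z = insert \<omega> (Y \<inter> \<Omega>) \<and> \<omega>(n := \<epsilon>) \<in> Y \<and> \<omega>(n := - \<epsilon>) \<in> Y"
    "combination Z (1 - x n * \<epsilon>) (\<lambda>i. x i - x n * \<epsilon> * (\<omega>(n := \<epsilon>)) i)"
    "0 < x n * \<epsilon> \<Longrightarrow> \<omega>(n := \<epsilon>) \<in> Y"
proof -
  let ?p = "\<omega>(n := \<epsilon>)" and ?m = "\<omega>(n := - \<epsilon>)"
  have two: "(1 :: 'a) + 1 \<noteq> 0"
    using less_imp_neq[OF add_pos_pos[OF zero_less_one_division_ring zero_less_one_division_ring]]
    by (rule not_sym)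
  have \<epsilon>0: "\<epsilon> \<noteq> 0" "\<epsilon> \<noteq> - \<epsilon>" "\<epsilon> * \<epsilon> = 1"
  proof -
    show "\<epsilon> \<noteq> 0" "\<epsilon> * \<epsilon> = 1" using \<epsilon> by auto
    show "\<epsilon> \<noteq> - \<epsilon>"
    proof
      assume "\<epsilon> = - \<epsilon>"
      then have "(1 :: 'a) = - 1" using \<epsilon> by auto
      then show False using two by (simp only: eq_neg_iff_add_eq_0)
    qed
  qed
  have \<Omega>_n: "y n = 0" if "y \<in> \<Omega>" for y
    using that \<Omega>(2) by (auto simp: coord_space_def)
  have ne: "?p \<notin> \<Omega>" "?m \<notin> \<Omega>" "?p \<noteq> ?m"
    using \<Omega>_n[of ?p] \<Omega>_n[of ?m] \<epsilon>0 by (auto dest: fun_cong[of _ _ n])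
  have finY: "finite Y" using Y \<Omega>(1) finite_subset by fastforce
  obtain c where c: "\<forall>a\<in>Y. 0 \<le> c a" "sum c Y = 1" "x = (\<lambda>i. \<Sum>a\<in>Y. c a * a i)"
    using x unfolding combination_def by auto
  define d where "d a = (if a \<in> Y then c a else 0)" for a
  define \<alpha> \<beta> where "\<alpha> = d ?p" and "\<beta> = d ?m"
  define Y0 where "Y0 = Y \<inter> \<Omega>"
  have nn: "0 \<le> \<alpha>" "0 \<le> \<beta>" using c(1) by (auto simp: \<alpha>_def \<beta>_def d_def)
  have sum_Y: "(\<Sum>a\<in>Y. c a * f a) = (\<Sum>a\<in>Y0. c a * f a) + \<alpha> * f ?p + \<beta> * f ?m" for f
  proof -
    have "(\<Sum>a\<in>Y. c a * f a) = (\<Sum>a\<in>Y0 \<union> {?p, ?m}. d a * f a)"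
      using Y finY by (intro sum.mono_neutral_cong_left) (auto simp: Y0_def d_def)
    also have "\<dots> = (\<Sum>a\<in>Y0. d a * f a) + (\<alpha> * f ?p + \<beta> * f ?m)"
      using finY ne by (subst sum.union_disjoint) (auto simp: Y0_def \<alpha>_def \<beta>_def)
    also have "(\<Sum>a\<in>Y0. d a * f a) = (\<Sum>a\<in>Y0. c a * f a)"
      by (intro sum.cong) (auto simp: Y0_def d_def)
    finally show ?thesis by (simp only: add.assoc)
  qed
  have total: "sum c Y0 + \<alpha> + \<beta> = 1"
    using sum_Y[of "\<lambda>_. 1"] c(2) by simp
  have "x n = (\<Sum>a\<in>Y0. c a * a n) + \<alpha> * \<epsilon> - \<beta> * \<epsilon>"
    unfolding c(3) sum_Y by simp
  also have "(\<Sum>a\<in>Y0. c a * a n) = 0"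
    using \<Omega>_n by (intro sum.neutral) (auto simp: Y0_def)
  finally have "x n * \<epsilon> = \<alpha> - \<beta>"
    using \<epsilon>0(3) by (simp add: left_diff_distrib mult.assoc)
  then have \<alpha>: "\<alpha> = x n * \<epsilon> + \<beta>" by simp
  define \<tau> where "\<tau> = x n * \<epsilon>"
  have \<tau>0: "0 \<le> \<tau>" using nonneg by (simp add: \<tau>_def)
  have \<alpha>\<tau>: "\<alpha> = \<tau> + \<beta>" using \<alpha> by (simp add: \<tau>_def)
  have rest: "combination Y0 (1 - \<tau> - (\<beta> + \<beta>)) (\<lambda>i. x i - \<tau> * ?p i - (\<beta> + \<beta>) * \<omega> i)"
    unfolding combination_def
  proof (intro exI[of _ c] conjI)
    show "\<forall>a\<in>Y0. 0 \<le> c a" using c(1) by (simp add: Y0_def)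
    show "sum c Y0 = 1 - \<tau> - (\<beta> + \<beta>)" using total \<alpha>\<tau> by (simp add: algebra_simps)
    have "x i - \<tau> * ?p i - (\<beta> + \<beta>) * \<omega> i = (\<Sum>a\<in>Y0. c a * a i)" for i
      unfolding c(3) sum_Y using \<alpha>\<tau> \<Omega>_n[OF \<Omega>(3)] by (simp add: algebra_simps)
    then show "(\<lambda>i. x i - \<tau> * ?p i - (\<beta> + \<beta>) * \<omega> i) = (\<lambda>i. \<Sum>a\<in>Y0. c a * a i)" by simp
  qed
  have p_in: "?p \<in> Y" if "0 < \<alpha>"
    using that by (auto simp: \<alpha>_def d_def split: if_splits)
  have m_in: "?m \<in> Y" if "0 < \<beta>"
    using that by (auto simp: \<beta>_def d_def split: if_splits)
  show thesis
  proof (cases "\<beta> = 0")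
    case True
    show thesis
      by (rule that[of Y0]) (use rest True p_in \<alpha>\<tau> in \<open>auto simp: Y0_def \<tau>_def[symmetric]\<close>)
  next
    case False
    then have \<beta>: "0 < \<beta>" using nn by simp
    then have "0 < \<alpha>" using \<alpha>\<tau> \<tau>0 by (simp add: add_nonneg_pos)
    have finZ: "finite (insert \<omega> Y0)" using finY by (simp add: Y0_def)
    have "combination (insert \<omega> Y0) (1 - \<tau> - (\<beta> + \<beta>) + (\<beta> + \<beta>))
        (\<lambda>i. (x i - \<tau> * ?p i - (\<beta> + \<beta>) * \<omega> i) + (\<beta> + \<beta>) * \<omega> i)"
      using nn finZ by (intro combination_add combination_mono[OF rest] combination_point) auto
    then have "combination (insert \<omega> Y0) (1 - \<tau>) (\<lambda>i. x i - \<tau> * ?p i)" by simp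
    then show thesis
      by (intro that[of "insert \<omega> Y0"]) (use p_in[OF \<open>0 < \<alpha>\<close>] m_in[OF \<beta>] in \<open>auto simp: Y0_def \<tau>_def\<close>)
  qed
qed

text \<open>
  Plenarity without reference to relatively convex sets: the hull of \<open>X\<close> meets \<open>\<Omega>\<close> in the least
  trace whose hull contains \<open>x\<close>.
\<close>

definition least_supports ::
    "(nat \<Rightarrow> 'a::{division_ring, linordered_ring_strict}) set \<Rightarrow> bool" where
  "least_supports \<Omega> \<longleftrightarrow>
     (\<forall>x \<in> convex_hull_of \<Omega>. \<exists>X\<subseteq>\<Omega>. x \<in> convex_hull_of X \<and>
        (\<forall>Y\<subseteq>\<Omega>. x \<in> convex_hull_of Y \<longrightarrow> X \<subseteq> convex_hull_of Y))"

locale antipodal_pair =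
  fixes \<Omega> :: "(nat \<Rightarrow> 'a::{division_ring, linordered_ring_strict}) set" and n \<omega>
  assumes finite_\<Omega>: "finite \<Omega>" and \<Omega>_coord: "\<Omega> \<subseteq> coord_space n" and \<omega>: "\<omega> \<in> \<Omega>"
begin

definition "north = \<omega>(n := 1)"
definition "south = \<omega>(n := - 1)"
definition "\<Omega>' = \<Omega> \<union> {north, south}"

lemma coord_n: "z \<in> \<Omega> \<Longrightarrow> z n = 0"
  using \<Omega>_coord by (auto simp: coord_space_def)

lemma pair_coord: "north n = 1" "south n = - 1"
  by (simp_all add: north_def south_def)

lemma pair_notin: "north \<notin> \<Omega>" "south \<notin> \<Omega>" "north \<noteq> south"
proof -
  show "north \<notin> \<Omega>" using coord_n[of north] pair_coord by auto
  show "south \<notin> \<Omega>" using coord_n[of south] pair_coord by auto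
  have "(1 :: 'a) + 1 \<noteq> 0"
    using less_imp_neq[OF add_pos_pos[OF zero_less_one_division_ring zero_less_one_division_ring]]
    by (rule not_sym)
  then have "(1 :: 'a) \<noteq> - 1" by (simp only: eq_neg_iff_add_eq_0 not_False_eq_True)
  then show "north \<noteq> south" using pair_coord by metis
qed

lemma finite_\<Omega>': "finite \<Omega>'"
  using finite_\<Omega> by (simp add: \<Omega>'_def)

lemma \<Omega>'_coord: "\<Omega>' \<subseteq> coord_space (Suc n)"
  using \<Omega>_coord \<omega> by (auto simp: \<Omega>'_def coord_space_def north_def south_def)

lemma \<omega>_hull_pair: "\<omega> \<in> convex_hull_of {north, south}"
  unfolding north_def south_def by (rule midpoint_in_hull) (rule coord_n[OF \<omega>])

lemma \<omega>_hull: "north \<in> Y \<Longrightarrow> south \<in> Y \<Longrightarrow> \<omega> \<in> convex_hull_of Y"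
  using \<omega>_hull_pair hull_mono[of "{north, south}" Y convex_set] by auto

lemma sign_cases:
  obtains p \<epsilon> where "p = north \<or> p = south" "\<epsilon> = 1 \<or> \<epsilon> = - 1" "p = \<omega>(n := \<epsilon>)" "p n = \<epsilon>"
    "0 \<le> (x :: nat \<Rightarrow> 'a) n * \<epsilon>"
proof (cases "0 \<le> x n")
  case True
  then show thesis using that[of north 1] by (simp add: north_def)
next
  case False
  then show thesis using that[of south "- 1"] by (simp add: south_def)
qed

lemma hull_split:
  assumes Y: "Y \<subseteq> \<Omega>'" and x: "x \<in> convex_hull_of Y" and \<epsilon>: "\<epsilon> = 1 \<or> \<epsilon> = - 1"
    and p: "p = \<omega>(n := \<epsilon>)" and nonneg: "0 \<le> x n * \<epsilon>"
  obtains Z where "Z = Y \<inter> \<Omega> \<or> Z = insert \<omega> (Y \<inter> \<Omega>) \<and> north \<in> Y \<and> south \<in> Y"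
    "combination Z (1 - x n * \<epsilon>) (\<lambda>i. x i - x n * \<epsilon> * p i)"
    "0 < x n * \<epsilon> \<Longrightarrow> p \<in> Y"
proof -
  have "finite Y" using Y finite_\<Omega>' finite_subset by blast
  then have "combination Y 1 x" using x convex_hull_finite by blast
  moreover have "{\<omega>(n := \<epsilon>), \<omega>(n := - \<epsilon>)} = {north, south}"
    using \<epsilon> by (auto simp: north_def south_def)
  then have pair: "Y \<subseteq> \<Omega> \<union> {\<omega>(n := \<epsilon>), \<omega>(n := - \<epsilon>)}"
      "\<omega>(n := \<epsilon>) \<in> Y \<and> \<omega>(n := - \<epsilon>) \<in> Y \<longleftrightarrow> north \<in> Y \<and> south \<in> Y"
    using Y by (auto simp: \<Omega>'_def doubleton_eq_iff)
  ultimately show thesis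
    using combination_split[OF finite_\<Omega> \<Omega>_coord \<omega> pair(1) \<epsilon>, of x] nonneg that
    unfolding p pair(2) by blast
qed

lemma split_finite: "Z = Y \<inter> \<Omega> \<or> Z = insert \<omega> (Y \<inter> \<Omega>) \<and> Q \<Longrightarrow> finite Z \<and> Z \<subseteq> \<Omega>"
  using finite_\<Omega> \<omega> by auto

text \<open>
  An old point has vanishing new coordinate, so its combinations reduce to old points, with \<open>\<omega>\<close>
  among them only if both new points occur.
\<close>

lemma old_point_in_hull:
  assumes Y: "Y \<subseteq> \<Omega>'" and z: "z \<in> \<Omega>" "z \<in> convex_hull_of Y"
  shows "z \<in> convex_hull_of (Y \<inter> \<Omega>) \<or>
    north \<in> Y \<and> south \<in> Y \<and> z \<in> convex_hull_of (insert \<omega> (Y \<inter> \<Omega>))"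
proof -
  have "0 \<le> z n * 1" using coord_n[OF z(1)] by simp
  then obtain Z where Z: "Z = Y \<inter> \<Omega> \<or> Z = insert \<omega> (Y \<inter> \<Omega>) \<and> north \<in> Y \<and> south \<in> Y"
    "combination Z (1 - z n * 1) (\<lambda>i. z i - z n * 1 * north i)"
    using hull_split[OF Y z(2), of 1 north] by (auto simp: north_def)
  then have "z \<in> convex_hull_of Z"
    using convex_hull_finite split_finite[OF Z(1)] coord_n[OF z(1)] by auto
  then show ?thesis using Z(1) by auto
qed

text \<open>
  The new points are the only ones where the new coordinate takes its extreme values.
\<close>

lemma new_point_in_hull:
  assumes Y: "Y \<subseteq> \<Omega>'" and z: "z = north \<or> z = south" "z \<in> convex_hull_of Y"
  shows "z \<in> Y"
proof -
  obtain \<epsilon> where \<epsilon>: "\<epsilon> = 1 \<or> \<epsilon> = - 1" "z = \<omega>(n := \<epsilon>)" "z n * \<epsilon> = 1"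
    using z(1) that[of 1] that[of "- 1"] by (auto simp: north_def south_def)
  have "0 < z n * \<epsilon>" using \<epsilon>(3) zero_less_one_division_ring[where 'a = 'a] by simp
  then show ?thesis
    using hull_split[OF Y z(2) \<epsilon>(1,2)] by (metis order_less_imp_le)
qed

text \<open>
  By \<open>hull_split\<close> each \<open>x\<close> in the new hull is a combination of one new point, with a weight \<open>\<tau>\<close>
  determined by \<open>x\<close>, and of a point \<open>y\<close> of the old hull, also determined by \<open>x\<close> if \<open>\<tau> \<noteq> 1\<close>.
  A least support of \<open>x\<close> is therefore a least support of \<open>y\<close>, together with the new point if \<open>\<tau> > 0\<close>.
\<close>

lemma least_supports_extend:
  assumes "least_supports \<Omega>"
  shows "least_supports \<Omega>'"
  unfolding least_supports_def
proof
  fix x assume x: "x \<in> convex_hull_of \<Omega>'"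
  obtain p \<epsilon> where p: "p = north \<or> p = south" and \<epsilon>: "\<epsilon> = 1 \<or> \<epsilon> = - 1" "p = \<omega>(n := \<epsilon>)" "p n = \<epsilon>"
    and nonneg: "0 \<le> x n * \<epsilon>"
    by (rule sign_cases)
  define \<tau> where "\<tau> = x n * \<epsilon>"
  have split: "\<exists>Z\<subseteq>\<Omega>. finite Z \<and> Z \<subseteq> convex_hull_of Y \<and> combination Z (1 - \<tau>) (\<lambda>i. x i - \<tau> * p i)
      \<and> (0 < \<tau> \<longrightarrow> p \<in> Y)" if Y: "Y \<subseteq> \<Omega>'" "x \<in> convex_hull_of Y" for Y
  proof -
    obtain Z where Z: "Z = Y \<inter> \<Omega> \<or> Z = insert \<omega> (Y \<inter> \<Omega>) \<and> north \<in> Y \<and> south \<in> Y"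
      "combination Z (1 - \<tau>) (\<lambda>i. x i - \<tau> * p i)" "0 < \<tau> \<Longrightarrow> p \<in> Y"
      using hull_split[OF Y \<epsilon>(1,2) nonneg] unfolding \<tau>_def by blast
    have "Z \<subseteq> convex_hull_of Y"
      using Z(1) \<omega>_hull[of Y] hull_subset[of Y convex_set] by auto
    then show ?thesis using Z split_finite[OF Z(1)] by blast
  qed
  obtain Z where Z: "Z \<subseteq> \<Omega>" "finite Z" "combination Z (1 - \<tau>) (\<lambda>i. x i - \<tau> * p i)"
    using split[OF order_refl x] by blast
  have "0 \<le> 1 - \<tau>" using combination_nonneg[OF Z(3)] .
  have "0 \<le> \<tau>" using nonneg by (simp add: \<tau>_def)
  show "\<exists>X\<subseteq>\<Omega>'. x \<in> convex_hull_of X \<and>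
      (\<forall>Y\<subseteq>\<Omega>'. x \<in> convex_hull_of Y \<longrightarrow> X \<subseteq> convex_hull_of Y)"
  proof (cases "\<tau> = 1")
    case True
    then have "(\<lambda>i. x i - p i) = (\<lambda>i. 0)"
      using combination_0[OF _ Z(2)] Z(3) by fastforce
    then have "x = p" by (simp add: fun_eq_iff)
    then show ?thesis
      using p split True zero_less_one_division_ring[where 'a = 'a]
      by (intro exI[of _ "{p}"]) (auto simp: \<Omega>'_def intro: hull_inc)
  next
    case False
    define s where "s = 1 - \<tau>"
    have s: "0 < s" "s \<noteq> 0" using False \<open>0 \<le> 1 - \<tau>\<close> by (auto simp: s_def)
    then have inv: "0 \<le> inverse s" using inverse_positive_division_ring[of s] by simp
    define y where "y = (\<lambda>i. inverse s * (x i - \<tau> * p i))"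
    have y: "y \<in> convex_hull_of Z" if "finite Z" "combination Z (1 - \<tau>) (\<lambda>i. x i - \<tau> * p i)" for Z
      using combination_scale[OF that(2) inv] s that(1)
      by (simp add: convex_hull_finite y_def s_def)
    have x_y: "x = (\<lambda>i. s * y i + \<tau> * p i)"
      using s by (simp add: y_def mult.assoc[symmetric])
    have "y \<in> convex_hull_of \<Omega>"
      using y[OF Z(2,3)] hull_mono[OF Z(1)] by blast
    then obtain X where X: "X \<subseteq> \<Omega>" "y \<in> convex_hull_of X"
      "\<And>Y. Y \<subseteq> \<Omega> \<Longrightarrow> y \<in> convex_hull_of Y \<Longrightarrow> X \<subseteq> convex_hull_of Y"
      using assms unfolding least_supports_def by metis
    define X' where "X' = (if \<tau> = 0 then X else insert p X)"
    have "x \<in> convex_hull_of X'"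
    proof (cases "\<tau> = 0")
      case True
      then have "x = y" using x_y by (simp add: s_def)
      then show ?thesis using X(2) True by (simp add: X'_def)
    next
      case False
      have "y \<in> convex_hull_of (insert p X)"
        using X(2) hull_mono[of X "insert p X" convex_set] by auto
      moreover have "p \<in> convex_hull_of (insert p X)" by (simp add: hull_inc)
      ultimately have "x \<in> convex_hull_of (insert p X)"
        unfolding x_y using s \<open>0 \<le> \<tau>\<close> by (intro hull_convex) (auto simp: s_def)
      then show ?thesis using False by (simp add: X'_def)
    qed
    moreover have "X' \<subseteq> convex_hull_of Y" if Y: "Y \<subseteq> \<Omega>'" "x \<in> convex_hull_of Y" for Y
    proof -
      obtain Z where Z: "Z \<subseteq> \<Omega>" "finite Z" "Z \<subseteq> convex_hull_of Y"
          "combination Z (1 - \<tau>) (\<lambda>i. x i - \<tau> * p i)" and pY: "0 < \<tau> \<longrightarrow> p \<in> Y"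
        using split[OF Y] by blast
      have "X \<subseteq> convex_hull_of Z" by (rule X(3)[OF Z(1) y[OF Z(2,4)]])
      also have "\<dots> \<subseteq> convex_hull_of Y" by (rule hull_subset_hull[OF Z(3)])
      finally show ?thesis
        using pY \<open>0 \<le> \<tau>\<close> by (auto simp: X'_def intro: hull_inc)
    qed
    moreover have "X' \<subseteq> \<Omega>'" using X(1) p by (auto simp: X'_def \<Omega>'_def)
    ultimately show ?thesis by blast
  qed
qed

end

section \<open>Labelled point configurations\<close>

text \<open>
  A smallest element is to be mapped to the empty set, so it must not occur as a label.
\<close>

definition nonzero :: "'l gorder \<Rightarrow> 'l set" where
  "nonzero L = {p \<in> carrier L. \<exists>q\<in>carrier L. \<not> p \<sqsubseteq>\<^bsub>L\<^esub> q}"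

text \<open>
  The pairs of labels that a point labelled \<open>p\<close> has to be placed between.
\<close>

definition splittings :: "'l gorder \<Rightarrow> ('l \<Rightarrow> nat) \<Rightarrow> 'l \<Rightarrow> ('l \<times> 'l) set" where
  "splittings L w p = {(a, b). a \<in> nonzero L \<and> b \<in> nonzero L \<and> p \<sqsubseteq>\<^bsub>L\<^esub> a \<squnion>\<^bsub>L\<^esub> b \<and> w a < w p \<and> w b < w p}"

text \<open>
  The condition on labels makes the points labelled below \<open>a\<close> a trace of a convex set. The condition
  on ranks excludes cycles of the relation \<open>D\<close> on the points; it is what makes the lattice of traces
  lower bounded.
\<close>

definition configuration ::
    "'l gorder \<Rightarrow> ('l \<Rightarrow> nat) \<Rightarrow> nat \<Rightarrow> (nat \<Rightarrow> 'a::{division_ring, linordered_ring_strict}) set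
      \<Rightarrow> ((nat \<Rightarrow> 'a) \<Rightarrow> 'l) \<Rightarrow> bool" where
  "configuration L w n \<Omega> e \<longleftrightarrow>
     finite \<Omega> \<and> \<Omega> \<subseteq> coord_space n \<and> (\<forall>x\<in>\<Omega>. \<forall>i. x i \<in> \<int>) \<and> least_supports \<Omega> \<and>
     e ` \<Omega> \<subseteq> nonzero L \<and>
     (\<forall>a\<in>carrier L. \<forall>z\<in>\<Omega>. z \<in> convex_hull_of {y \<in> \<Omega>. e y \<sqsubseteq>\<^bsub>L\<^esub> a} \<longrightarrow> e z \<sqsubseteq>\<^bsub>L\<^esub> a) \<and>
     (\<forall>z\<in>\<Omega>. \<forall>Y\<subseteq>\<Omega>. z \<in> convex_hull_of Y \<longrightarrow>
        z \<in> Y \<or> z \<in> convex_hull_of {y \<in> Y. w (e y) < w (e z)})"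

definition realized ::
    "(nat \<Rightarrow> 'a::{division_ring, linordered_ring_strict}) set \<Rightarrow> ((nat \<Rightarrow> 'a) \<Rightarrow> 'l)
      \<Rightarrow> (nat \<Rightarrow> 'a) \<Rightarrow> 'l \<Rightarrow> 'l \<Rightarrow> bool" where
  "realized \<Omega> e z a b \<longleftrightarrow> (\<exists>s\<in>\<Omega>. \<exists>t\<in>\<Omega>. e s = a \<and> e t = b \<and> z \<in> convex_hull_of {s, t})"

lemma realized_mono:
  "realized \<Omega> e z a b \<Longrightarrow> \<Omega> \<subseteq> \<Omega>' \<Longrightarrow> \<forall>x\<in>\<Omega>. e' x = e x \<Longrightarrow> realized \<Omega>' e' z a b"
  unfolding realized_def by (metis subsetD)

text \<open>
  The two antipodal points around \<open>\<omega>\<close> get the labels \<open>a\<close> and \<open>b\<close>. Labels still respect hulls because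
  \<open>e \<omega>\<close> is below \<open>a \<squnion> b\<close>: whenever the two new points are labelled below \<open>c\<close>, so is \<open>\<omega>\<close>. Ranks still
  decrease because wherever \<open>\<omega>\<close> helps to generate a point, the two new points of lower rank can be
  used instead.
\<close>

lemma configuration_realize:
  fixes \<Omega> :: "(nat \<Rightarrow> 'a::{division_ring, linordered_ring_strict}) set"
  assumes "lattice L" and conf: "configuration L w n \<Omega> e" and \<omega>: "\<omega> \<in> \<Omega>"
    and ab: "(a, b) \<in> splittings L w (e \<omega>)"
  shows "\<exists>\<Omega>' e'. configuration L w (Suc n) \<Omega>' e' \<and> \<Omega> \<subseteq> \<Omega>' \<and> (\<forall>z\<in>\<Omega>. e' z = e z) \<and>
    (\<forall>z\<in>\<Omega>' - \<Omega>. w (e' z) < w (e \<omega>)) \<and> realized \<Omega>' e' \<omega> a b"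
proof -
  interpret lattice L by fact
  have \<Omega>: "finite \<Omega>" "\<Omega> \<subseteq> coord_space n" "\<forall>x\<in>\<Omega>. \<forall>i. x i \<in> \<int>" "least_supports \<Omega>"
      "e ` \<Omega> \<subseteq> nonzero L"
    and label: "\<And>c z. c \<in> carrier L \<Longrightarrow> z \<in> \<Omega> \<Longrightarrow> z \<in> convex_hull_of {y \<in> \<Omega>. e y \<sqsubseteq>\<^bsub>L\<^esub> c} \<Longrightarrow> e z \<sqsubseteq>\<^bsub>L\<^esub> c"
    and rank: "\<And>z Y. z \<in> \<Omega> \<Longrightarrow> Y \<subseteq> \<Omega> \<Longrightarrow> z \<in> convex_hull_of Y \<Longrightarrow>
        z \<in> Y \<or> z \<in> convex_hull_of {y \<in> Y. w (e y) < w (e z)}"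
    using conf unfolding configuration_def by auto
  interpret antipodal_pair \<Omega> n \<omega> by unfold_locales (use \<Omega> \<omega> in auto)
  have ab': "a \<in> nonzero L" "b \<in> nonzero L" "a \<in> carrier L" "b \<in> carrier L" "e \<omega> \<in> carrier L"
    and le: "e \<omega> \<sqsubseteq>\<^bsub>L\<^esub> a \<squnion>\<^bsub>L\<^esub> b" and w: "w a < w (e \<omega>)" "w b < w (e \<omega>)"
    using ab \<Omega>(5) \<omega> unfolding splittings_def nonzero_def by auto
  define e' where "e' = e(north := a, south := b)"
  have e'_old: "e' z = e z" if "z \<in> \<Omega>" for z
    using that pair_notin by (auto simp: e'_def)
  have e'_new: "e' north = a" "e' south = b"
    using pair_notin by (auto simp: e'_def)
  have "e' z \<sqsubseteq>\<^bsub>L\<^esub> c"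
    if c: "c \<in> carrier L" and z: "z \<in> \<Omega>'" "z \<in> convex_hull_of {y \<in> \<Omega>'. e' y \<sqsubseteq>\<^bsub>L\<^esub> c}" for c z
  proof -
    let ?Y = "{y \<in> \<Omega>'. e' y \<sqsubseteq>\<^bsub>L\<^esub> c}"
    show ?thesis
    proof (cases "z \<in> \<Omega>")
      case False
      then have "z = north \<or> z = south" using z(1) by (auto simp: \<Omega>'_def)
      from new_point_in_hull[OF _ this z(2)] show ?thesis by auto
    next
      case True
      have Y: "?Y \<inter> \<Omega> = {y \<in> \<Omega>. e y \<sqsubseteq>\<^bsub>L\<^esub> c}"
        using e'_old by (auto simp: \<Omega>'_def)
      have "insert \<omega> (?Y \<inter> \<Omega>) = ?Y \<inter> \<Omega>" if "north \<in> ?Y" "south \<in> ?Y"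
      proof -
        have "a \<sqsubseteq>\<^bsub>L\<^esub> c" "b \<sqsubseteq>\<^bsub>L\<^esub> c" using that e'_new by auto
        then have "a \<squnion>\<^bsub>L\<^esub> b \<sqsubseteq>\<^bsub>L\<^esub> c" using ab' c by (simp add: join_le_iff)
        then have "e \<omega> \<sqsubseteq>\<^bsub>L\<^esub> c" using le_trans[OF le] ab' c by simp
        then show ?thesis using \<omega> unfolding Y by auto
      qed
      then have "z \<in> convex_hull_of (?Y \<inter> \<Omega>)"
        using old_point_in_hull[OF _ True z(2)] by auto
      then show ?thesis
        using label[OF c True] e'_old[OF True] unfolding Y by simp
    qed
  qed
  moreover have "z \<in> Y \<or> z \<in> convex_hull_of {y \<in> Y. w (e' y) < w (e' z)}"
    if z: "z \<in> \<Omega>'" and Y: "Y \<subseteq> \<Omega>'" "z \<in> convex_hull_of Y" for z Y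
  proof (cases "z \<in> \<Omega>")
    case False
    then have "z = north \<or> z = south" using z by (auto simp: \<Omega>'_def)
    from new_point_in_hull[OF Y(1) this Y(2)] show ?thesis ..
  next
    case True
    let ?low = "\<lambda>Y. {y \<in> Y. w (e' y) < w (e' z)}"
    have low_old: "?low A = {y \<in> A. w (e y) < w (e z)}" if "A \<subseteq> \<Omega>" for A
      using that e'_old True by auto
    from old_point_in_hull[OF Y(1) True Y(2)] show ?thesis
    proof (elim disjE conjE)
      assume "z \<in> convex_hull_of (Y \<inter> \<Omega>)"
      then have "z \<in> Y \<or> z \<in> convex_hull_of (?low (Y \<inter> \<Omega>))"
        using rank[OF True, of "Y \<inter> \<Omega>"] low_old[of "Y \<inter> \<Omega>"] by auto
      then show ?thesis
        using hull_mono[of "?low (Y \<inter> \<Omega>)" "?low Y" convex_set] by auto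
    next
      assume pair: "north \<in> Y" "south \<in> Y" and "z \<in> convex_hull_of (insert \<omega> (Y \<inter> \<Omega>))"
      then have z_low: "z \<in> insert \<omega> (Y \<inter> \<Omega>) \<or> z \<in> convex_hull_of (?low (insert \<omega> (Y \<inter> \<Omega>)))"
        using rank[OF True, of "insert \<omega> (Y \<inter> \<Omega>)"] low_old[of "insert \<omega> (Y \<inter> \<Omega>)"] \<omega> by auto
      have \<omega>_low: "\<omega> \<in> convex_hull_of (?low Y)" if "w (e \<omega>) \<le> w (e z)"
        using that pair w e'_new e'_old[OF True] by (intro \<omega>_hull) auto
      have "?low (insert \<omega> (Y \<inter> \<Omega>)) \<subseteq> convex_hull_of (?low Y)"
      proof
        fix y assume y: "y \<in> ?low (insert \<omega> (Y \<inter> \<Omega>))"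
        show "y \<in> convex_hull_of (?low Y)"
        proof (cases "y = \<omega>")
          case True
          then show ?thesis using y \<omega>_low e'_old[OF \<omega>] e'_old[OF \<open>z \<in> \<Omega>\<close>] by auto
        next
          case False
          then show ?thesis using y by (auto intro: hull_inc)
        qed
      qed
      then have "convex_hull_of (?low (insert \<omega> (Y \<inter> \<Omega>))) \<subseteq> convex_hull_of (?low Y)"
        by (rule hull_subset_hull)
      then show ?thesis using z_low \<omega>_low by auto
    qed
  qed
  moreover have "\<forall>x\<in>\<Omega>'. \<forall>i. x i \<in> \<int>"
    using \<Omega>(3) \<omega> by (auto simp: \<Omega>'_def north_def south_def)
  moreover have "e' ` \<Omega>' \<subseteq> nonzero L"
    using \<Omega>(5) ab' e'_old e'_new by (auto simp: \<Omega>'_def)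
  ultimately have "configuration L w (Suc n) \<Omega>' e'"
    unfolding configuration_def
    using finite_\<Omega>' \<Omega>'_coord least_supports_extend[OF \<Omega>(4)] by blast
  moreover have "realized \<Omega>' e' \<omega> a b"
    unfolding realized_def using \<omega>_hull_pair e'_new
    by (intro bexI[of _ north] bexI[of _ south]) (auto simp: \<Omega>'_def)
  moreover have "\<forall>z\<in>\<Omega>' - \<Omega>. w (e' z) < w (e \<omega>)"
    using w e'_new by (auto simp: \<Omega>'_def)
  ultimately show ?thesis
    using e'_old by (intro exI[of _ \<Omega>'] exI[of _ e']) (auto simp: \<Omega>'_def)
qed

lemma configuration_realize_many:
  assumes "lattice L" and "finite F" and "configuration L w n \<Omega> e"
    and "\<forall>(z, a, b)\<in>F. z \<in> \<Omega> \<and> (a, b) \<in> splittings L w (e z) \<and> w (e z) = r"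
  shows "\<exists>n' \<Omega>' e'. configuration L w n' \<Omega>' e' \<and> \<Omega> \<subseteq> \<Omega>' \<and> (\<forall>z\<in>\<Omega>. e' z = e z) \<and>
    (\<forall>z\<in>\<Omega>' - \<Omega>. w (e' z) < r) \<and> (\<forall>(z, a, b)\<in>F. realized \<Omega>' e' z a b)"
  using assms(2-4)
proof (induction F rule: finite_induct)
  case empty
  then show ?case by (intro exI[of _ n] exI[of _ \<Omega>] exI[of _ e]) auto
next
  case (insert x F)
  obtain z a b where x: "x = (z, a, b)" by (cases x) auto
  from insert obtain n' \<Omega>' e' where IH: "configuration L w n' \<Omega>' e'" "\<Omega> \<subseteq> \<Omega>'" "\<forall>z\<in>\<Omega>. e' z = e z"
    "\<forall>z\<in>\<Omega>' - \<Omega>. w (e' z) < r" "\<forall>(z, a, b)\<in>F. realized \<Omega>' e' z a b"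
    by auto
  have z: "z \<in> \<Omega>'" "(a, b) \<in> splittings L w (e' z)" "w (e' z) = r"
    using insert.prems(2) x IH(2,3) by auto
  obtain \<Omega>'' e'' where step: "configuration L w (Suc n') \<Omega>'' e''" "\<Omega>' \<subseteq> \<Omega>''" "\<forall>z\<in>\<Omega>'. e'' z = e' z"
    "\<forall>y\<in>\<Omega>'' - \<Omega>'. w (e'' y) < w (e' z)" "realized \<Omega>'' e'' z a b"
    using configuration_realize[OF assms(1) IH(1) z(1,2)] by blast
  have "\<forall>y\<in>\<Omega>'' - \<Omega>. w (e'' y) < r"
    using IH(4) step(3,4) z(3) by (metis Diff_iff)
  moreover have "\<forall>(z, a, b)\<in>insert x F. realized \<Omega>'' e'' z a b"
    using IH(5) realized_mono[OF _ step(2,3)] step(5) x by auto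
  ultimately show ?case
    using step IH by (intro exI[of _ "Suc n'"] exI[of _ \<Omega>''] exI[of _ e'']) auto
qed

text \<open>
  The requirements are treated by descending rank of the points. Points added for requirements of
  rank \<open>r\<close> have rank below \<open>r\<close>, so a rank once finished stays finished.
\<close>

lemma configuration_saturate:
  assumes "lattice L" and fin: "finite (carrier L)" and conf: "configuration L w n \<Omega> e"
  shows "\<exists>n' \<Omega>' e'. configuration L w n' \<Omega>' e' \<and> \<Omega> \<subseteq> \<Omega>' \<and> (\<forall>z\<in>\<Omega>. e' z = e z) \<and>
    (\<forall>z\<in>\<Omega>'. \<forall>(a, b)\<in>splittings L w (e' z). realized \<Omega>' e' z a b)"
proof -
  define N where "N = Suc (Max (w ` carrier L \<union> {0}))"
  have w_less: "w p < N" if "p \<in> carrier L" for p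
    unfolding N_def using that fin by (intro le_imp_less_Suc Max_ge) auto
  have "\<exists>n' \<Omega>' e'. configuration L w n' \<Omega>' e' \<and> \<Omega> \<subseteq> \<Omega>' \<and> (\<forall>z\<in>\<Omega>. e' z = e z) \<and>
    (\<forall>z\<in>\<Omega>'. N - k \<le> w (e' z) \<longrightarrow> (\<forall>(a, b)\<in>splittings L w (e' z). realized \<Omega>' e' z a b))" for k
  proof (induction k)
    case 0
    have "\<not> N \<le> w (e z)" if "z \<in> \<Omega>" for z
      using conf w_less that unfolding configuration_def nonzero_def by (auto simp: not_le)
    then show ?case using conf by (intro exI[of _ n] exI[of _ \<Omega>] exI[of _ e]) auto
  next
    case (Suc k)
    then obtain n' \<Omega>' e' where IH: "configuration L w n' \<Omega>' e'" "\<Omega> \<subseteq> \<Omega>'" "\<forall>z\<in>\<Omega>. e' z = e z"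
      "\<forall>z\<in>\<Omega>'. N - k \<le> w (e' z) \<longrightarrow> (\<forall>(a, b)\<in>splittings L w (e' z). realized \<Omega>' e' z a b)"
      by auto
    define r where "r = N - Suc k"
    define F where "F = {(z, a, b). z \<in> \<Omega>' \<and> (a, b) \<in> splittings L w (e' z) \<and> w (e' z) = r}"
    have "F \<subseteq> \<Omega>' \<times> carrier L \<times> carrier L"
      by (auto simp: F_def splittings_def nonzero_def)
    then have finF: "finite F"
      by (rule finite_subset) (use IH(1) fin in \<open>simp add: configuration_def\<close>)
    have F: "\<forall>(z, a, b)\<in>F. z \<in> \<Omega>' \<and> (a, b) \<in> splittings L w (e' z) \<and> w (e' z) = r"
      by (auto simp: F_def)
    obtain n'' \<Omega>'' e'' where step: "configuration L w n'' \<Omega>'' e''" "\<Omega>' \<subseteq> \<Omega>''"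
      "\<forall>z\<in>\<Omega>'. e'' z = e' z" "\<forall>z\<in>\<Omega>'' - \<Omega>'. w (e'' z) < r" "\<forall>(z, a, b)\<in>F. realized \<Omega>'' e'' z a b"
      using configuration_realize_many[OF assms(1) finF IH(1) F] by (elim exE conjE)
    have "realized \<Omega>'' e'' z a b"
      if z: "z \<in> \<Omega>''" "r \<le> w (e'' z)" and ab: "(a, b) \<in> splittings L w (e'' z)" for z a b
    proof -
      have "z \<in> \<Omega>'" using step(4) z by (metis Diff_iff not_le)
      then have e: "e'' z = e' z" using step(3) by simp
      show ?thesis
      proof (cases "w (e' z) = r")
        case True
        then have "(z, a, b) \<in> F" using ab e \<open>z \<in> \<Omega>'\<close> by (simp add: F_def)
        then show ?thesis using step(5) by auto
      next
        case False
        then have "N - k \<le> w (e' z)" using z(2) e by (simp add: r_def)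
        then have "realized \<Omega>' e' z a b" using IH(4) \<open>z \<in> \<Omega>'\<close> ab e by auto
        then show ?thesis using realized_mono step(2,3) by metis
      qed
    qed
    then show ?case
      using step IH by (intro exI[of _ n''] exI[of _ \<Omega>''] exI[of _ e'']) (auto simp: r_def)
  qed
  from this[of N] show ?thesis by simp
qed

text \<open>
  The vertices of a simplex are affinely independent: the hull of \<open>Y\<close> contains \<open>x\<close> exactly if \<open>Y\<close>
  contains the vertices with nonzero weight in \<open>x\<close>, so all conditions hold trivially.
\<close>

lemma configuration_initial:
  assumes fin: "finite (carrier L)"
  shows "\<exists>n (\<Omega> :: (nat \<Rightarrow> 'a::{division_ring, linordered_ring_strict}) set) e.
    configuration L w n \<Omega> e \<and> nonzero L \<subseteq> e ` \<Omega>"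
proof -
  define N where "N = card (nonzero L)"
  have "finite (nonzero L)" using fin by (simp add: nonzero_def)
  then obtain lab where lab: "bij_betw lab {..<N} (nonzero L)"
    using ex_bij_betw_nat_finite by (auto simp: atLeast0LessThan N_def)
  define u :: "nat \<Rightarrow> nat \<Rightarrow> 'a" where "u j = (\<lambda>i. if i = j then 1 else 0)" for j
  define \<Omega> where "\<Omega> = u ` {..<N}"
  \<comment> \<open>on the unit vector \<open>u j\<close> the first nonzero coordinate is \<open>j\<close>\<close>
  define e where "e x = lab (LEAST i. x i \<noteq> 0)" for x :: "nat \<Rightarrow> 'a"
  have u_nz: "u j i \<noteq> 0 \<longleftrightarrow> i = j" for i j by (simp add: u_def)
  have e_u: "e (u j) = lab j" for j
    unfolding e_def u_nz using Least_equality[of "\<lambda>i. i = j" j] by simp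
  have support: "u j \<in> Y" if "Y \<subseteq> \<Omega>" "x \<in> convex_hull_of Y" "x j \<noteq> 0" for Y x j
    using hull_nonzero_coordinate[OF that(2,3)] that(1) u_nz by (auto simp: \<Omega>_def)
  have extreme: "z \<in> Y" if "z \<in> \<Omega>" "Y \<subseteq> \<Omega>" "z \<in> convex_hull_of Y" for z Y
    using that support[OF that(2,3)] u_nz by (auto simp: \<Omega>_def)
  have fin\<Omega>: "finite \<Omega>" by (simp add: \<Omega>_def)
  have "least_supports \<Omega>"
    unfolding least_supports_def
  proof
    fix x assume "x \<in> convex_hull_of \<Omega>"
    then obtain c where c: "\<forall>a\<in>\<Omega>. 0 \<le> c a" "sum c \<Omega> = 1" "x = (\<lambda>i. \<Sum>a\<in>\<Omega>. c a * a i)"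
      using convex_hull_finite[OF fin\<Omega>] by (auto simp: combination_def)
    define X where "X = {a \<in> \<Omega>. c a \<noteq> 0}"
    have sum_X: "(\<Sum>a\<in>\<Omega>. c a * f a) = (\<Sum>a\<in>X. c a * f a)" for f
      using fin\<Omega> by (intro sum.mono_neutral_right) (auto simp: X_def)
    have "combination X 1 x"
      unfolding combination_def
    proof (intro exI[of _ c] conjI)
      show "\<forall>a\<in>X. 0 \<le> c a" using c(1) by (simp add: X_def)
      show "sum c X = 1" using c(2) sum_X[of "\<lambda>_. 1"] by simp
      show "x = (\<lambda>i. \<Sum>a\<in>X. c a * a i)" unfolding c(3) sum_X ..
    qed
    then have "x \<in> convex_hull_of X"
      using convex_hull_finite[of X] fin\<Omega> by (simp add: X_def)
    moreover have "X \<subseteq> convex_hull_of Y" if Y: "Y \<subseteq> \<Omega>" "x \<in> convex_hull_of Y" for Y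
    proof
      fix a assume a: "a \<in> X"
      then obtain j where j: "j < N" "a = u j" by (auto simp: X_def \<Omega>_def)
      have "x j = (\<Sum>b\<in>\<Omega>. if b = a then c a else 0)"
        unfolding c(3)
      proof (rule sum.cong[OF HOL.refl])
        fix b assume "b \<in> \<Omega>"
        then obtain i where i: "b = u i" by (auto simp: \<Omega>_def)
        have "b = a \<longleftrightarrow> i = j" using u_nz[of i i] u_nz[of j i] i j(2) by auto
        moreover have "b j = (if i = j then 1 else 0)" using i by (simp add: u_def)
        ultimately show "c b * b j = (if b = a then c a else 0)" by (cases "i = j") simp_all
      qed
      also have "\<dots> = c a" using a fin\<Omega> by (simp add: X_def)
      finally have "x j \<noteq> 0" using a by (simp add: X_def)
      then show "a \<in> convex_hull_of Y" using support[OF Y] j by (auto intro: hull_inc)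
    qed
    ultimately show "\<exists>X\<subseteq>\<Omega>. x \<in> convex_hull_of X \<and>
        (\<forall>Y\<subseteq>\<Omega>. x \<in> convex_hull_of Y \<longrightarrow> X \<subseteq> convex_hull_of Y)"
      by (intro exI[of _ X]) (auto simp: X_def)
  qed
  moreover have "e z \<sqsubseteq>\<^bsub>L\<^esub> a" if "z \<in> \<Omega>" "z \<in> convex_hull_of {y \<in> \<Omega>. e y \<sqsubseteq>\<^bsub>L\<^esub> a}" for a z
    using extreme[OF that(1) _ that(2)] by auto
  moreover have "e ` \<Omega> = nonzero L"
    using lab by (auto simp: \<Omega>_def image_image e_u bij_betw_def)
  ultimately have "configuration L w N \<Omega> e"
    unfolding configuration_def using fin\<Omega> extreme
    by (auto simp: \<Omega>_def coord_space_def u_def)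
  then show ?thesis using \<open>e ` \<Omega> = nonzero L\<close> by blast
qed

section \<open>Intersections of polytopes\<close>

definition support :: "('i \<Rightarrow> 'a::zero) \<Rightarrow> 'i set" where
  "support x = {i. x i \<noteq> 0}"

text \<open>
  The solutions of a system of linear equations in nonnegative weights with a fixed sum. Closure
  under affine combinations replaces the equations, so that no linear algebra over the
  division ring is needed.
\<close>

locale simplex_section =
  fixes I :: "'i set" and P :: "('i \<Rightarrow> 'a::{division_ring, linordered_ring_strict}) set" and \<kappa> :: 'a
  assumes finite_I: "finite I" and \<kappa>: "0 < \<kappa>"
    and off: "\<And>x i. x \<in> P \<Longrightarrow> i \<notin> I \<Longrightarrow> x i = 0"
    and nonneg: "\<And>x i. x \<in> P \<Longrightarrow> 0 \<le> x i"
    and total: "\<And>x. x \<in> P \<Longrightarrow> sum x I = \<kappa>"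
    and affine: "\<And>x y s t. x \<in> P \<Longrightarrow> y \<in> P \<Longrightarrow> s + t = 1 \<Longrightarrow> (\<And>i. 0 \<le> s * x i + t * y i) \<Longrightarrow>
      (\<lambda>i. s * x i + t * y i) \<in> P"
begin

lemma support_subset: "x \<in> P \<Longrightarrow> support x \<subseteq> I"
  using off by (auto simp: support_def)

lemma finite_support: "x \<in> P \<Longrightarrow> finite (support x)"
  using support_subset finite_I finite_subset by blast

text \<open>
  Subtract from \<open>x\<close> the largest multiple of \<open>y\<close> that keeps all weights nonnegative. A coordinate of
  \<open>y\<close> vanishes in the difference, which is then rescaled to the sum \<open>\<kappa>\<close>.
\<close>

lemma support_reduction:
  assumes x: "x \<in> P" and y: "y \<in> P" and sub: "support y \<subseteq> support x" and "x \<noteq> y"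
  obtains t z where "0 < t" "t < 1" "z \<in> P" "support z \<subset> support x" "x = (\<lambda>i. t * y i + (1 - t) * z i)"
proof -
  have pos: "0 < y i" if "i \<in> support y" for i
    using that nonneg[OF y, of i] by (simp add: support_def)
  have "support y \<noteq> {}"
  proof
    assume "support y = {}"
    then have "sum y I = 0" by (intro sum.neutral) (auto simp: support_def)
    then show False using total[OF y] \<kappa> by simp
  qed
  \<comment> \<open>scalars act from the left, so \<open>t * y i \<le> x i\<close> means \<open>t \<le> x i * inverse (y i)\<close>\<close>
  define ratio where "ratio i = x i * inverse (y i)" for i
  define t where "t = Min (ratio ` support y)"
  have fin: "finite (ratio ` support y)" "ratio ` support y \<noteq> {}"
    using finite_support[OF y] \<open>support y \<noteq> {}\<close> by auto
  obtain k where k: "k \<in> support y" "t = ratio k"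
    using Min_in[OF fin] unfolding t_def by auto
  have t_le: "t * y i \<le> x i" for i
  proof (cases "i \<in> support y")
    case True
    then have "t \<le> ratio i" unfolding t_def using fin(1) by simp
    then have "t * y i \<le> ratio i * y i" using pos[OF True] by (intro mult_right_mono) auto
    also have "\<dots> = x i" using pos[OF True] by (simp add: ratio_def mult.assoc)
    finally show ?thesis .
  next
    case False
    then show ?thesis using nonneg[OF x, of i] by (simp add: support_def)
  qed
  have "0 < x k" using k(1) sub nonneg[OF x, of k] by (auto simp: support_def less_le)
  then have "0 < t"
    unfolding k(2) ratio_def using pos[OF k(1)] inverse_positive_division_ring by (intro mult_pos_pos) auto
  have k_zero: "x k - t * y k = 0"
    using pos[OF k(1)] by (simp add: k(2) ratio_def mult.assoc)
  have sum_diff: "(\<Sum>i\<in>I. x i - t * y i) = (1 - t) * \<kappa>"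
    using total[OF x] total[OF y] by (simp add: sum_subtractf sum_distrib_left[symmetric] left_diff_distrib)
  have sum_nonneg: "0 \<le> (\<Sum>i\<in>I. x i - t * y i)"
    using t_le by (intro sum_nonneg) simp
  have "t \<noteq> 1"
  proof
    assume "t = 1"
    then have "\<forall>i\<in>I. x i - y i = 0"
      using sum_diff t_le finite_I by (subst sum_nonneg_eq_0_iff[symmetric]) auto
    then have "x i = y i" for i
      using off[OF x, of i] off[OF y, of i] by (cases "i \<in> I") auto
    then show False using \<open>x \<noteq> y\<close> by auto
  qed
  have "\<not> 1 - t < 0"
    using sum_nonneg \<kappa> mult_neg_pos[of "1 - t" \<kappa>] unfolding sum_diff by auto
  with \<open>t \<noteq> 1\<close> have "t < 1" by auto
  define s where "s = 1 - t"
  have s: "0 < s" "s \<noteq> 0" using \<open>t < 1\<close> by (auto simp: s_def)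
  have inv: "0 < inverse s" using s inverse_positive_division_ring by blast
  define z where "z = (\<lambda>i. inverse s * x i + (- (inverse s * t)) * y i)"
  have z_eq: "z i = inverse s * (x i - t * y i)" for i
    by (simp add: z_def right_diff_distrib mult.assoc)
  have "inverse s + - (inverse s * t) = inverse s * s"
    by (simp add: s_def right_diff_distrib)
  also have "\<dots> = 1" using s by simp
  finally have coeffs: "inverse s + - (inverse s * t) = 1" .
  have "0 \<le> z i" for i
    unfolding z_eq using t_le[of i] inv by (intro mult_nonneg_nonneg) auto
  then have "z \<in> P"
    unfolding z_def by (intro affine x y coeffs)
  moreover have "support z \<subset> support x"
  proof
    show "support z \<subseteq> support x"
    proof
      fix i assume i: "i \<in> support z"
      show "i \<in> support x"
      proof (rule ccontr)
        assume "i \<notin> support x"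
        then have "x i = 0" "y i = 0" using sub by (auto simp: support_def)
        then show False using i by (simp add: support_def z_eq)
      qed
    qed
    have "k \<notin> support z" using k_zero by (simp add: support_def z_eq)
    then show "support z \<noteq> support x" using k(1) sub by auto
  qed
  moreover have "x = (\<lambda>i. t * y i + (1 - t) * z i)"
  proof
    fix i
    have "(1 - t) * z i = x i - t * y i"
      using s by (simp add: z_eq s_def[symmetric] mult.assoc[symmetric])
    then show "x i = t * y i + (1 - t) * z i" by simp
  qed
  ultimately show thesis using that \<open>0 < t\<close> \<open>t < 1\<close> by blast
qed

text \<open>
  The vertices of the section: by \<open>support_reduction\<close> a vertex is determined by its support, and
  every element is a convex combination of vertices by induction on the size of its support.
\<close>

definition extreme :: "('i \<Rightarrow> 'a) set" where
  "extreme = {x \<in> P. \<forall>y\<in>P. \<not> support y \<subset> support x}"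

lemma finite_extreme: "finite extreme"
proof -
  have "inj_on support extreme"
  proof
    fix x y assume x: "x \<in> extreme" and y: "y \<in> extreme" and eq: "support x = support y"
    show "x = y"
    proof (rule ccontr)
      assume "x \<noteq> y"
      have P: "x \<in> P" "y \<in> P" "support y \<subseteq> support x"
        using x y eq by (auto simp: extreme_def)
      obtain z where "z \<in> P" "support z \<subset> support x"
        by (rule support_reduction[OF P \<open>x \<noteq> y\<close>]) (rule that; assumption)
      then show False using x by (auto simp: extreme_def)
    qed
  qed
  moreover have "support ` extreme \<subseteq> Pow I"
    using support_subset by (auto simp: extreme_def)
  ultimately show ?thesis
    using finite_I inj_on_finite by blast
qed

lemma extreme_generates:
  assumes "extreme \<subseteq> H"
    and "\<And>x y s t. x \<in> H \<Longrightarrow> y \<in> H \<Longrightarrow> 0 \<le> s \<Longrightarrow> 0 \<le> t \<Longrightarrow> s + t = 1 \<Longrightarrow>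
      (\<lambda>i. s * x i + t * y i) \<in> H"
  shows "P \<subseteq> H"
proof
  fix x assume "x \<in> P"
  then show "x \<in> H"
  proof (induction "card (support x)" arbitrary: x rule: less_induct)
    case less
    show ?case
    proof (cases "x \<in> extreme")
      case False
      then obtain y where y: "y \<in> P" "support y \<subset> support x"
        using less.prems by (auto simp: extreme_def)
      then obtain t z where z: "0 < t" "t < 1" "z \<in> P" "support z \<subset> support x"
          and eq: "x = (\<lambda>i. t * y i + (1 - t) * z i)"
        using support_reduction[OF less.prems y(1)] by (metis psubset_eq)
      have "y \<in> H" "z \<in> H"
        using less.hyps y z psubset_card_mono[OF finite_support[OF less.prems]] by auto
      then show ?thesis
        using z(1,2) by (subst eq) (intro assms(2), auto)
    qed (use assms(1) in auto)
  qed
qed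

end

text \<open>
  A point of the intersection is given by weights on \<open>A\<close> and weights on \<open>B\<close> that define the
  same point. Such pairs of weights form a section of a simplex on the disjoint sum of \<open>A\<close> and \<open>B\<close>,
  and the vertices of the section are mapped to finitely many generators.
\<close>

lemma polytope_Int:
  fixes A B :: "(nat \<Rightarrow> 'a::{division_ring, linordered_ring_strict}) set"
  assumes A: "finite A" and B: "finite B"
  obtains C where "finite C" "convex_hull_of A \<inter> convex_hull_of B = convex_hull_of C"
proof -
  define pt where "pt c = (\<lambda>j. \<Sum>a\<in>A. c (Inl a :: (nat \<Rightarrow> 'a) + (nat \<Rightarrow> 'a)) * a j)"
    for c :: "(nat \<Rightarrow> 'a) + (nat \<Rightarrow> 'a) \<Rightarrow> 'a"
  define P where "P = {c. (\<forall>i. 0 \<le> c i) \<and> (\<forall>i. i \<notin> A <+> B \<longrightarrow> c i = 0) \<and>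
      (\<Sum>a\<in>A. c (Inl a)) = 1 \<and> (\<Sum>b\<in>B. c (Inr b)) = 1 \<and> pt c = (\<lambda>j. \<Sum>b\<in>B. c (Inr b) * b j)}"
  have two: "0 < (1 :: 'a) + 1"
    by (intro add_pos_pos zero_less_one_division_ring)
  have pt_affine: "pt (\<lambda>i. s * x i + t * y i) = (\<lambda>j. s * pt x j + t * pt y j)" for s t x y
    by (simp add: pt_def distrib_right sum.distrib sum_distrib_left mult.assoc)
  interpret simplex_section "A <+> B" P "1 + 1"
  proof
    show "finite (A <+> B)" using A B by simp
    show "0 < (1 :: 'a) + 1" by (rule two)
    show "sum x (A <+> B) = 1 + 1" if "x \<in> P" for x
      using that A B by (simp add: sum.Plus P_def)
    fix x y and s t :: 'a
    assume x: "x \<in> P" and y: "y \<in> P" and st: "s + t = 1" and nn: "\<And>i. 0 \<le> s * x i + t * y i"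
    have "s * pt x j + t * pt y j = (\<Sum>b\<in>B. (s * x (Inr b) + t * y (Inr b)) * b j)" for j
    proof -
      have "pt x j = (\<Sum>b\<in>B. x (Inr b) * b j)" "pt y j = (\<Sum>b\<in>B. y (Inr b) * b j)"
        using x y by (auto simp: P_def)
      then show ?thesis
        by (simp add: distrib_right sum.distrib sum_distrib_left mult.assoc)
    qed
    then show "(\<lambda>i. s * x i + t * y i) \<in> P"
      using x y st nn
      by (auto simp: P_def pt_affine sum.distrib sum_distrib_left[symmetric])
  qed (auto simp: P_def)
  have pt_hull: "pt c \<in> convex_hull_of A \<inter> convex_hull_of B" if "c \<in> P" for c
    using that A B unfolding P_def
    by (auto simp: convex_hull_finite combination_def pt_def
        intro: exI[of _ "\<lambda>a. c (Inl a)"] exI[of _ "\<lambda>b. c (Inr b)"])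
  define C where "C = pt ` extreme"
  have "convex_hull_of C \<subseteq> convex_hull_of A \<inter> convex_hull_of B"
  proof (rule hull_minimal)
    show "C \<subseteq> convex_hull_of A \<inter> convex_hull_of B"
      using pt_hull by (auto simp: C_def extreme_def)
    show "convex_set (convex_hull_of A \<inter> convex_hull_of B)"
      using convex_set_hull[of A] convex_set_hull[of B] unfolding convex_set_def by blast
  qed
  moreover have "convex_hull_of A \<inter> convex_hull_of B \<subseteq> convex_hull_of C"
  proof
    fix x assume "x \<in> convex_hull_of A \<inter> convex_hull_of B"
    then obtain c d where c: "\<forall>a\<in>A. 0 \<le> c a" "sum c A = 1" "x = (\<lambda>i. \<Sum>a\<in>A. c a * a i)"
      and d: "\<forall>b\<in>B. 0 \<le> d b" "sum d B = 1" "x = (\<lambda>i. \<Sum>b\<in>B. d b * b i)"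
      using A B by (auto simp: convex_hull_finite combination_def)
    define g where "g = case_sum (\<lambda>a. if a \<in> A then c a else 0) (\<lambda>b. if b \<in> B then d b else 0)"
    have "pt g = x"
      unfolding pt_def c(3) by (auto simp: g_def intro!: sum.cong)
    moreover have "x = (\<lambda>j. \<Sum>b\<in>B. g (Inr b) * b j)"
      unfolding d(3) by (auto simp: g_def intro!: sum.cong)
    ultimately have "g \<in> P"
      using c(1,2) d(1,2) by (auto simp: P_def g_def split: sum.splits)
    moreover have "P \<subseteq> {g. pt g \<in> convex_hull_of C}"
      by (rule extreme_generates) (auto simp: C_def pt_affine intro: hull_inc hull_convex)
    ultimately show "x \<in> convex_hull_of C"
      using \<open>pt g = x\<close> by auto
  qed
  ultimately have "convex_hull_of A \<inter> convex_hull_of B = convex_hull_of C"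
    by (intro subset_antisym)
  moreover have "finite C" using finite_extreme by (simp add: C_def)
  ultimately show thesis using that by blast
qed

section \<open>Lattices of polytopes and of traces of convex sets\<close>

lemma hull_empty: "convex_hull_of {} = {}"
  by (rule hull_same) (simp add: convex_set_def)

lemma partial_order_inclusion: "partial_order (inclusion_order C)"
  by unfold_locales auto

lemma polytopes_lub:
  assumes "A \<in> carrier (polytopes n)" "B \<in> carrier (polytopes n)"
  shows "is_lub (polytopes n) (convex_hull_of (A \<union> B)) {A, B}"
proof -
  obtain S T where S: "finite S" "S \<subseteq> coord_space n" "A = convex_hull_of S"
    and T: "finite T" "T \<subseteq> coord_space n" "B = convex_hull_of T"
    using assms by (auto simp: polytopes_def)
  have "convex_hull_of (A \<union> B) = convex_hull_of (S \<union> T)"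
    unfolding S(3) T(3) by (rule hull_Un[symmetric]) (auto simp: convex_set_def)
  then have "convex_hull_of (A \<union> B) \<in> carrier (polytopes n)"
    using S T by (auto simp: polytopes_def)
  moreover have "convex_hull_of (A \<union> B) \<subseteq> U"
    if "U \<in> carrier (polytopes n)" "A \<subseteq> U" "B \<subseteq> U" for U
    using that by (intro hull_minimal) (auto simp: polytopes_def convex_set_hull)
  ultimately show ?thesis
    using assms hull_subset[of "A \<union> B" convex_set]
    by (subst is_lub_pair) (auto simp: polytopes_def)
qed

lemma polytopes_glb:
  assumes "A \<in> carrier (polytopes n)" "B \<in> carrier (polytopes n)"
  shows "is_glb (polytopes n) (A \<inter> B) {A, B}"
proof -
  obtain S T where S: "finite S" "S \<subseteq> coord_space n" "A = convex_hull_of S"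
    and T: "finite T" "T \<subseteq> coord_space n" "B = convex_hull_of T"
    using assms by (auto simp: polytopes_def)
  obtain C where C: "finite C" "A \<inter> B = convex_hull_of C"
    using polytope_Int[OF S(1) T(1)] S T by auto
  have "C \<subseteq> coord_space n"
    using hull_subset[of C convex_set] hull_coord_space[OF S(2)] C(2) S(3) by auto
  then have "A \<inter> B \<in> carrier (polytopes n)" using C by (auto simp: polytopes_def)
  then show ?thesis using assms by (subst is_glb_pair) (auto simp: polytopes_def)
qed

lemma partial_order_polytopes: "partial_order (polytopes n)"
  unfolding polytopes_def by (rule partial_order_inclusion)

lemma lattice_polytopes:
  "lattice (polytopes n :: (nat \<Rightarrow> 'a::{division_ring, linordered_ring_strict}) set gorder)"
  by (rule lattice_if_lubs_glbs[OF partial_order_polytopes]) (use polytopes_lub polytopes_glb in blast)+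

lemmas polytopes_join = partial_order.join_eqI[OF partial_order_polytopes polytopes_lub]
lemmas polytopes_meet = partial_order.meet_eqI[OF partial_order_polytopes polytopes_glb]

lemma carrier_Co_rel:
  assumes "\<Omega> \<subseteq> coord_space n"
  shows "carrier (Co_rel n \<Omega>) = {Y. Y \<subseteq> \<Omega> \<and> convex_hull_of Y \<inter> \<Omega> \<subseteq> Y}"
proof (intro subset_antisym subsetI)
  fix Y assume "Y \<in> carrier (Co_rel n \<Omega>)"
  then obtain X where X: "convex_set X" "Y = X \<inter> \<Omega>"
    by (auto simp: Co_rel_def Co_def)
  then have "convex_hull_of Y \<subseteq> X" by (intro hull_minimal) auto
  then show "Y \<in> {Y. Y \<subseteq> \<Omega> \<and> convex_hull_of Y \<inter> \<Omega> \<subseteq> Y}" using X by auto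
next
  fix Y assume "Y \<in> {Y. Y \<subseteq> \<Omega> \<and> convex_hull_of Y \<inter> \<Omega> \<subseteq> Y}"
  then have Y: "Y \<subseteq> \<Omega>" "Y = convex_hull_of Y \<inter> \<Omega>" using hull_subset[of Y convex_set] by auto
  moreover have "convex_hull_of Y \<subseteq> coord_space n"
    using Y(1) assms by (intro hull_coord_space) auto
  ultimately show "Y \<in> carrier (Co_rel n \<Omega>)"
    by (auto simp: Co_rel_def Co_def convex_set_hull intro!: exI[of _ "convex_hull_of Y"])
qed

lemma le_Co_rel: "X \<sqsubseteq>\<^bsub>Co_rel n \<Omega>\<^esub> Y \<longleftrightarrow> X \<subseteq> Y"
  by (simp add: Co_rel_def)

lemma partial_order_Co_rel: "partial_order (Co_rel n \<Omega>)"
  unfolding Co_rel_def by (rule partial_order_inclusion)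

lemma hull_trace_in_Co_rel:
  assumes "\<Omega> \<subseteq> coord_space n"
  shows "convex_hull_of X \<inter> \<Omega> \<in> carrier (Co_rel n \<Omega>)"
  using hull_subset_hull[of "convex_hull_of X \<inter> \<Omega>" X] by (auto simp: carrier_Co_rel[OF assms])

lemma Co_rel_lub:
  assumes \<Omega>: "\<Omega> \<subseteq> coord_space n" and A: "A \<in> carrier (Co_rel n \<Omega>)" and B: "B \<in> carrier (Co_rel n \<Omega>)"
  shows "is_lub (Co_rel n \<Omega>) (convex_hull_of (A \<union> B) \<inter> \<Omega>) {A, B}"
proof -
  have "convex_hull_of (A \<union> B) \<inter> \<Omega> \<subseteq> U"
    if "U \<in> carrier (Co_rel n \<Omega>)" "A \<subseteq> U" "B \<subseteq> U" for U
    using that hull_mono[of "A \<union> B" U convex_set] by (auto simp: carrier_Co_rel[OF \<Omega>])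
  then show ?thesis
    using A B hull_trace_in_Co_rel[OF \<Omega>] hull_subset[of "A \<union> B" convex_set]
    by (subst is_lub_pair) (auto simp: carrier_Co_rel[OF \<Omega>] le_Co_rel)
qed

lemma Co_rel_glb:
  assumes \<Omega>: "\<Omega> \<subseteq> coord_space n" and A: "A \<in> carrier (Co_rel n \<Omega>)" and B: "B \<in> carrier (Co_rel n \<Omega>)"
  shows "is_glb (Co_rel n \<Omega>) (A \<inter> B) {A, B}"
proof -
  have "A \<inter> B \<in> carrier (Co_rel n \<Omega>)"
    using A B hull_mono[of "A \<inter> B" A convex_set] hull_mono[of "A \<inter> B" B convex_set]
    by (auto simp: carrier_Co_rel[OF \<Omega>])
  then show ?thesis using A B by (subst is_glb_pair) (auto simp: le_Co_rel)
qed

lemma lattice_Co_rel: "\<Omega> \<subseteq> coord_space n \<Longrightarrow> lattice (Co_rel n \<Omega>)"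
  by (rule lattice_if_lubs_glbs[OF partial_order_Co_rel]) (use Co_rel_lub Co_rel_glb in blast)+

lemmas Co_rel_join = partial_order.join_eqI[OF partial_order_Co_rel Co_rel_lub]
lemmas Co_rel_meet = partial_order.meet_eqI[OF partial_order_Co_rel Co_rel_glb]

lemma plenary_set_if_least_supports:
  assumes \<Omega>: "\<Omega> \<subseteq> coord_space n" and "least_supports \<Omega>"
  shows "plenary_set n \<Omega>"
  unfolding plenary_set_def
proof (intro conjI ballI)
  fix x assume "x \<in> convex_hull_of \<Omega>"
  then obtain X where X: "X \<subseteq> \<Omega>" "x \<in> convex_hull_of X"
    "\<And>Y. Y \<subseteq> \<Omega> \<Longrightarrow> x \<in> convex_hull_of Y \<Longrightarrow> X \<subseteq> convex_hull_of Y"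
    using assms(2) unfolding least_supports_def by metis
  define Z where "Z = convex_hull_of X \<inter> \<Omega>"
  have "X \<subseteq> Z" using X(1) hull_subset[of X convex_set] by (auto simp: Z_def)
  then have "x \<in> convex_hull_of Z" using X(2) hull_mono[of X Z convex_set] by auto
  moreover have "Z \<subseteq> Y" if Y: "Y \<in> carrier (Co_rel n \<Omega>)" "x \<in> convex_hull_of Y" for Y
  proof -
    have "X \<subseteq> convex_hull_of Y" using X(3) Y by (simp add: carrier_Co_rel[OF \<Omega>])
    then have "Z \<subseteq> convex_hull_of Y \<inter> \<Omega>" unfolding Z_def using hull_subset_hull by blast
    then show ?thesis using Y(1) by (auto simp: carrier_Co_rel[OF \<Omega>])
  qed
  ultimately have "least (Co_rel n \<Omega>) Z {Y \<in> carrier (Co_rel n \<Omega>). x \<in> convex_hull_of Y}"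
    using hull_trace_in_Co_rel[OF \<Omega>, of X] by (auto simp: least_def le_Co_rel Z_def)
  then show "\<exists>X. least (Co_rel n \<Omega>) X {Y \<in> carrier (Co_rel n \<Omega>). x \<in> convex_hull_of Y}" ..
qed (rule \<Omega>)

section \<open>The embeddings given by a saturated configuration\<close>

locale saturated_configuration = lattice L for L :: "'l gorder" (structure) +
  fixes w :: "'l \<Rightarrow> nat" and n and \<Omega> :: "(nat \<Rightarrow> 'a::{division_ring, linordered_ring_strict}) set"
    and e :: "(nat \<Rightarrow> 'a) \<Rightarrow> 'l"
  assumes conf: "configuration L w n \<Omega> e" and labels: "nonzero L \<subseteq> e ` \<Omega>"
    and saturated: "\<And>z a b. z \<in> \<Omega> \<Longrightarrow> a \<in> carrier L \<Longrightarrow> b \<in> carrier L \<Longrightarrow> e z \<sqsubseteq> a \<squnion> b \<Longrightarrow>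
      z \<in> convex_hull_of {y \<in> \<Omega>. e y \<sqsubseteq> a \<or> e y \<sqsubseteq> b}"
begin

definition "\<psi> a = {z \<in> \<Omega>. e z \<sqsubseteq> a}"

lemma \<Omega>: "finite \<Omega>" "\<Omega> \<subseteq> coord_space n" "\<forall>x\<in>\<Omega>. \<forall>i. x i \<in> \<int>" "least_supports \<Omega>"
  and e_nonzero: "z \<in> \<Omega> \<Longrightarrow> e z \<in> nonzero L"
  and e_closed: "z \<in> \<Omega> \<Longrightarrow> e z \<in> carrier L"
  and label: "a \<in> carrier L \<Longrightarrow> z \<in> \<Omega> \<Longrightarrow> z \<in> convex_hull_of (\<psi> a) \<Longrightarrow> e z \<sqsubseteq> a"
  and rank: "z \<in> \<Omega> \<Longrightarrow> Y \<subseteq> \<Omega> \<Longrightarrow> z \<in> convex_hull_of Y \<Longrightarrow>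
        z \<in> Y \<or> z \<in> convex_hull_of {y \<in> Y. w (e y) < w (e z)}"
  using conf unfolding configuration_def \<psi>_def nonzero_def by auto

lemma \<psi>_subset: "\<psi> a \<subseteq> \<Omega>"
  by (auto simp: \<psi>_def)

lemma hull_\<psi>: "a \<in> carrier L \<Longrightarrow> convex_hull_of (\<psi> a) \<inter> \<Omega> = \<psi> a"
  using label hull_subset[of "\<psi> a" convex_set] by (auto simp: \<psi>_def)

lemma \<psi>_closed: "a \<in> carrier L \<Longrightarrow> \<psi> a \<in> carrier (Co_rel n \<Omega>)"
  using hull_trace_in_Co_rel[OF \<Omega>(2), of "\<psi> a"] by (simp add: hull_\<psi>)

lemma \<psi>_mono: "a \<in> carrier L \<Longrightarrow> b \<in> carrier L \<Longrightarrow> a \<sqsubseteq> b \<Longrightarrow> \<psi> a \<subseteq> \<psi> b"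
  using e_closed le_trans by (auto simp: \<psi>_def)

lemma \<psi>_meet: "a \<in> carrier L \<Longrightarrow> b \<in> carrier L \<Longrightarrow> \<psi> (a \<sqinter> b) = \<psi> a \<inter> \<psi> b"
  using e_closed by (auto simp: \<psi>_def le_meet_iff)

lemma hull_\<psi>_join:
  assumes "a \<in> carrier L" "b \<in> carrier L"
  shows "convex_hull_of (\<psi> a \<union> \<psi> b) = convex_hull_of (\<psi> (a \<squnion> b))"
proof
  have "\<psi> a \<union> \<psi> b \<subseteq> \<psi> (a \<squnion> b)"
    using assms \<psi>_mono[of a "a \<squnion> b"] \<psi>_mono[of b "a \<squnion> b"] by (simp add: join_left join_right)
  then show "convex_hull_of (\<psi> a \<union> \<psi> b) \<subseteq> convex_hull_of (\<psi> (a \<squnion> b))" by (rule hull_mono)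
  have "\<psi> a \<union> \<psi> b = {y \<in> \<Omega>. e y \<sqsubseteq> a \<or> e y \<sqsubseteq> b}" by (auto simp: \<psi>_def)
  then have "\<psi> (a \<squnion> b) \<subseteq> convex_hull_of (\<psi> a \<union> \<psi> b)"
    using saturated assms by (auto simp: \<psi>_def)
  then show "convex_hull_of (\<psi> (a \<squnion> b)) \<subseteq> convex_hull_of (\<psi> a \<union> \<psi> b)" by (rule hull_subset_hull)
qed

lemma \<psi>_join:
  assumes "a \<in> carrier L" "b \<in> carrier L"
  shows "\<psi> (a \<squnion> b) = \<psi> a \<squnion>\<^bsub>Co_rel n \<Omega>\<^esub> \<psi> b"
  using assms by (simp add: Co_rel_join[OF \<Omega>(2)] \<psi>_closed hull_\<psi>_join hull_\<psi>)

text \<open>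
  A least support of a common point of the two hulls is contained in both \<open>\<psi> a\<close> and \<open>\<psi> b\<close>.
\<close>

lemma hull_\<psi>_meet:
  assumes "a \<in> carrier L" "b \<in> carrier L"
  shows "convex_hull_of (\<psi> (a \<sqinter> b)) = convex_hull_of (\<psi> a) \<inter> convex_hull_of (\<psi> b)"
proof
  show "convex_hull_of (\<psi> (a \<sqinter> b)) \<subseteq> convex_hull_of (\<psi> a) \<inter> convex_hull_of (\<psi> b)"
    using assms by (auto simp: \<psi>_meet intro: hull_mono[THEN subsetD])
  show "convex_hull_of (\<psi> a) \<inter> convex_hull_of (\<psi> b) \<subseteq> convex_hull_of (\<psi> (a \<sqinter> b))"
  proof
    fix x assume x: "x \<in> convex_hull_of (\<psi> a) \<inter> convex_hull_of (\<psi> b)"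
    then have "x \<in> convex_hull_of \<Omega>" using hull_mono[OF \<psi>_subset[of a]] by auto
    then obtain X where X: "X \<subseteq> \<Omega>" "x \<in> convex_hull_of X"
      "\<And>Y. Y \<subseteq> \<Omega> \<Longrightarrow> x \<in> convex_hull_of Y \<Longrightarrow> X \<subseteq> convex_hull_of Y"
      using \<Omega>(4) unfolding least_supports_def by metis
    have "X \<subseteq> \<psi> a" "X \<subseteq> \<psi> b"
      using X(1) X(3)[OF \<psi>_subset] x hull_\<psi> assms by blast+
    then show "x \<in> convex_hull_of (\<psi> (a \<sqinter> b))"
      using X(2) hull_mono[of X "\<psi> (a \<sqinter> b)" convex_set] by (auto simp: \<psi>_meet assms)
  qed
qed

text \<open>
  An element that is not the smallest one is a label, and it is recovered from the trace as the label
  of one of its points; the smallest element is below everything anyway.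
\<close>

lemma \<psi>_inj: "inj_on \<psi> (carrier L)"
proof
  have le: "a \<sqsubseteq> b" if "a \<in> carrier L" "b \<in> carrier L" "\<psi> a = \<psi> b" for a b
  proof (cases "a \<in> nonzero L")
    case True
    then obtain z where "z \<in> \<Omega>" "e z = a" using labels by auto
    then have "z \<in> \<psi> a" using that(1) by (simp add: \<psi>_def)
    then have "z \<in> \<psi> b" by (simp only: that(3))
    then show ?thesis using \<open>e z = a\<close> by (simp add: \<psi>_def)
  next
    case False
    then show ?thesis using that by (auto simp: nonzero_def)
  qed
  fix a b assume "a \<in> carrier L" "b \<in> carrier L" "\<psi> a = \<psi> b"
  then show "a = b" using le[of a b] le[of b a] by (simp add: le_antisym)
qed

lemma \<psi>_zero: "least L z (carrier L) \<Longrightarrow> \<psi> z = {}"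
  using e_nonzero le_trans unfolding least_def nonzero_def \<psi>_def by blast

lemma zero_preserving_\<psi>: "zero_preserving L (Co_rel n \<Omega>) \<psi>"
proof -
  have "{} \<in> carrier (Co_rel n \<Omega>)"
    by (simp add: carrier_Co_rel[OF \<Omega>(2)] hull_empty)
  then show ?thesis
    unfolding zero_preserving_def by (simp add: \<psi>_zero least_def le_Co_rel)
qed

lemma zero_preserving_hull_\<psi>: "zero_preserving L (polytopes n) (\<lambda>a. convex_hull_of (\<psi> a))"
  unfolding zero_preserving_def
proof (intro allI impI)
  fix z assume "least L z (carrier L)"
  then have "convex_hull_of (\<psi> z) = {}"
    by (simp add: \<psi>_zero hull_empty)
  then show "least (polytopes n) (convex_hull_of (\<psi> z)) (carrier (polytopes n))"
    by (auto simp: least_def polytopes_def hull_empty intro!: exI[of _ "{}"])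
qed

lemma hull_\<psi>_closed: "convex_hull_of (\<psi> a) \<in> carrier (polytopes n)"
  using \<Omega>(1,2) \<psi>_subset[of a] by (auto simp: polytopes_def intro: finite_subset)

lemma lattice_embedding_\<psi>: "lattice_embedding L (Co_rel n \<Omega>) \<psi>"
  unfolding lattice_embedding_def lattice_hom_def join_pres_def meet_pres_def
  using lattice_axioms lattice_Co_rel[OF \<Omega>(2)] \<psi>_inj \<psi>_closed
  by (auto simp: \<psi>_join \<psi>_meet Co_rel_meet[OF \<Omega>(2)])

lemma lattice_embedding_hull_\<psi>: "lattice_embedding L (polytopes n) (\<lambda>a. convex_hull_of (\<psi> a))"
proof -
  have "inj_on (\<lambda>a. convex_hull_of (\<psi> a)) (carrier L)"
    using \<psi>_inj hull_\<psi> unfolding inj_on_def by metis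
  moreover have "convex_hull_of (\<psi> (a \<squnion> b)) = convex_hull_of (\<psi> a) \<squnion>\<^bsub>polytopes n\<^esub> convex_hull_of (\<psi> b)"
    if "a \<in> carrier L" "b \<in> carrier L" for a b
  proof -
    have "convex_hull_of (convex_hull_of (\<psi> a) \<union> convex_hull_of (\<psi> b)) = convex_hull_of (\<psi> a \<union> \<psi> b)"
      by (rule hull_Un[symmetric]) (auto simp: convex_set_def)
    then show ?thesis using that by (simp add: polytopes_join hull_\<psi>_closed hull_\<psi>_join)
  qed
  ultimately show ?thesis
    unfolding lattice_embedding_def lattice_hom_def join_pres_def meet_pres_def
    using lattice_axioms lattice_polytopes
    by (auto simp: hull_\<psi>_meet polytopes_meet hull_\<psi>_closed)
qed

lemma plenary_map_hull_\<psi>: "plenary_map n L (\<lambda>a. convex_hull_of (\<psi> a))"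
proof -
  have "preserves_existing_meets L (Co_rel n \<Omega>) \<psi>"
    unfolding preserves_existing_meets_def
  proof (intro allI impI)
    fix X m assume X: "X \<subseteq> carrier L" and m: "is_glb L m X"
    have m_closed: "m \<in> carrier L" using m by auto
    show "is_glb (Co_rel n \<Omega>) (\<psi> m) (\<psi> ` X)"
    proof (rule greatest_LowerI)
      show "\<psi> ` X \<subseteq> carrier (Co_rel n \<Omega>)" "\<psi> m \<in> carrier (Co_rel n \<Omega>)"
        using X m_closed \<psi>_closed by auto
      show "\<psi> m \<sqsubseteq>\<^bsub>Co_rel n \<Omega>\<^esub> A" if A: "A \<in> \<psi> ` X" for A
      proof -
        obtain x where "x \<in> X" "A = \<psi> x" using A by auto
        then show ?thesis
          using \<psi>_mono[OF m_closed, of x] X greatest_Lower_below[OF m] by (auto simp: le_Co_rel)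
      qed
      show "Y \<sqsubseteq>\<^bsub>Co_rel n \<Omega>\<^esub> \<psi> m" if Y: "Y \<in> Lower (Co_rel n \<Omega>) (\<psi> ` X)" for Y
      proof -
        have "Y \<subseteq> \<Omega>" using Y by (auto simp: Lower_def carrier_Co_rel[OF \<Omega>(2)])
        have "e z \<sqsubseteq> x" if "z \<in> Y" "x \<in> X" for z x
        proof -
          have "Y \<subseteq> \<psi> x" using Y that(2) X \<psi>_closed by (auto simp: Lower_def le_Co_rel)
          then show ?thesis using that(1) by (auto simp: \<psi>_def)
        qed
        then have "e z \<in> Lower L X" if "z \<in> Y" for z
          using that e_closed \<open>Y \<subseteq> \<Omega>\<close> by (auto simp: Lower_def)
        then show ?thesis
          using m \<open>Y \<subseteq> \<Omega>\<close> by (auto simp: greatest_def le_Co_rel \<psi>_def)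
      qed
    qed
  qed
  then show ?thesis
    unfolding plenary_map_def using plenary_set_if_least_supports[OF \<Omega>(2,4)] \<psi>_closed \<psi>_join
    by (intro exI[of _ \<Omega>] exI[of _ \<psi>]) auto
qed

text \<open>
  The join irreducible traces are the singletons, ranked like their points. The empty trace is added
  because the criterion wants an element of the dense set below every trace; its rank is an
  arbitrary value, as the empty trace has no nontrivial covers.
\<close>

lemma lower_bounded_Co_rel: "lower_bounded_lattice (Co_rel n \<Omega>)"
proof -
  have le: "(X \<sqsubseteq>\<^bsub>Co_rel n \<Omega>\<^esub> Y) = (X \<subseteq> Y)" for X Y by (rule le_Co_rel)
  have singleton_hull: "convex_hull_of {z} = {z}" for z :: "nat \<Rightarrow> 'a"
    by (rule hull_same) (auto simp: convex_set_def distrib_right[symmetric])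
  define P where "P = insert {} ((\<lambda>z. {z}) ` \<Omega>)"
  show ?thesis
  proof (rule lower_bounded_if_ranked[where P = P and d = "\<lambda>Y. w (e (the_elem Y))"])
    show "lattice (Co_rel n \<Omega>)" by (rule lattice_Co_rel[OF \<Omega>(2)])
    show "finite (carrier (Co_rel n \<Omega>))"
      by (rule finite_subset[of _ "Pow \<Omega>"]) (auto simp: carrier_Co_rel[OF \<Omega>(2)] \<Omega>(1))
    show "P \<subseteq> carrier (Co_rel n \<Omega>)"
      by (auto simp: P_def carrier_Co_rel[OF \<Omega>(2)] hull_empty singleton_hull)
    show "\<exists>p\<in>P. p \<sqsubseteq>\<^bsub>Co_rel n \<Omega>\<^esub> a" for a
      by (intro bexI[of _ "{}"]) (auto simp: P_def le)
    show "a \<sqsubseteq>\<^bsub>Co_rel n \<Omega>\<^esub> b"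
      if "a \<in> carrier (Co_rel n \<Omega>)" "\<And>p. p \<in> P \<Longrightarrow> p \<sqsubseteq>\<^bsub>Co_rel n \<Omega>\<^esub> a \<Longrightarrow> p \<sqsubseteq>\<^bsub>Co_rel n \<Omega>\<^esub> b" for a b
      using that(1) that(2)[of "{_}"] by (auto simp: P_def le carrier_Co_rel[OF \<Omega>(2)])
    fix p a b
    assume "p \<in> P" and a: "a \<in> carrier (Co_rel n \<Omega>)" and b: "b \<in> carrier (Co_rel n \<Omega>)"
      and p: "p \<sqsubseteq>\<^bsub>Co_rel n \<Omega>\<^esub> a \<squnion>\<^bsub>Co_rel n \<Omega>\<^esub> b" "\<not> p \<sqsubseteq>\<^bsub>Co_rel n \<Omega>\<^esub> a" "\<not> p \<sqsubseteq>\<^bsub>Co_rel n \<Omega>\<^esub> b"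
    then obtain z where z: "z \<in> \<Omega>" "p = {z}" by (auto simp: P_def le)
    have ab: "a \<union> b \<subseteq> \<Omega>" using a b by (auto simp: carrier_Co_rel[OF \<Omega>(2)])
    have "z \<in> convex_hull_of (a \<union> b)" "z \<notin> a \<union> b"
      using p z a b by (auto simp: le Co_rel_join[OF \<Omega>(2)])
    then have low: "z \<in> convex_hull_of {y \<in> a \<union> b. w (e y) < w (e z)}"
      using rank[OF z(1) ab] by blast
    define E where "E = {y \<in> a \<union> b. w (e y) < w (e z)}"
    have "E \<noteq> {}"
    proof
      assume "E = {}"
      then show False using low unfolding E_def[symmetric] by (simp add: hull_empty)
    qed
    moreover have "z \<in> u" if "u \<in> carrier (Co_rel n \<Omega>)" "E \<subseteq> u" for u
      using that low hull_mono[of E u convex_set] z(1) unfolding E_def[symmetric]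
      by (auto simp: carrier_Co_rel[OF \<Omega>(2)])
    ultimately show "\<exists>E\<subseteq>P. E \<noteq> {} \<and>
        (\<forall>q\<in>E. (q \<sqsubseteq>\<^bsub>Co_rel n \<Omega>\<^esub> a \<or> q \<sqsubseteq>\<^bsub>Co_rel n \<Omega>\<^esub> b) \<and> w (e (the_elem q)) < w (e (the_elem p))) \<and>
        (\<forall>u\<in>carrier (Co_rel n \<Omega>). (\<forall>q\<in>E. q \<sqsubseteq>\<^bsub>Co_rel n \<Omega>\<^esub> u) \<longrightarrow> p \<sqsubseteq>\<^bsub>Co_rel n \<Omega>\<^esub> u)"
      using ab z(2) by (intro exI[of _ "(\<lambda>y. {y}) ` E"]) (auto simp: le P_def E_def)
  qed
qed

end

section \<open>Embeddings of finite lower bounded lattices\<close>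

text \<open>
  The labels supplied by the rank are never the smallest element: if one of \<open>a'\<close> and \<open>b'\<close> were, the
  other one alone would lie above \<open>e z\<close>.
\<close>

lemma saturated_configuration_exists:
  fixes L (structure)
  assumes "lattice L" and fin: "finite (carrier L)" and "lower_bounded_lattice L"
  obtains w n and \<Omega> :: "(nat \<Rightarrow> 'a::{division_ring, linordered_ring_strict}) set" and e
  where "saturated_configuration L w n \<Omega> e"
proof -
  interpret lattice L by fact
  obtain w :: "_ \<Rightarrow> nat" where w:
    "\<And>p a b. p \<in> carrier L \<Longrightarrow> a \<in> carrier L \<Longrightarrow> b \<in> carrier L \<Longrightarrow>
       p \<sqsubseteq> a \<squnion> b \<Longrightarrow> \<not> p \<sqsubseteq> a \<Longrightarrow> \<not> p \<sqsubseteq> b \<Longrightarrow>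
       \<exists>a'\<in>carrier L. \<exists>b'\<in>carrier L.
         a' \<sqsubseteq> a \<and> b' \<sqsubseteq> b \<and> p \<sqsubseteq> a' \<squnion> b' \<and> w a' < w p \<and> w b' < w p"
    using lower_bounded_split_rank[OF assms] by blast
  obtain n0 and \<Omega>0 :: "(nat \<Rightarrow> 'a) set" and e0
    where init: "configuration L w n0 \<Omega>0 e0" "nonzero L \<subseteq> e0 ` \<Omega>0"
    using configuration_initial[OF fin] by blast
  obtain n \<Omega> e where sat: "configuration L w n \<Omega> e" "\<Omega>0 \<subseteq> \<Omega>" "\<forall>z\<in>\<Omega>0. e z = e0 z"
    "\<forall>z\<in>\<Omega>. \<forall>(a, b)\<in>splittings L w (e z). realized \<Omega> e z a b"
    using configuration_saturate[OF assms(1,2) init(1)] by (elim exE conjE)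
  have "nonzero L \<subseteq> e ` \<Omega>"
  proof
    fix p assume "p \<in> nonzero L"
    then obtain z where "z \<in> \<Omega>0" "p = e0 z" using init(2) by auto
    then have "z \<in> \<Omega>" "p = e z" using sat(2,3) by auto
    then show "p \<in> e ` \<Omega>" by simp
  qed
  moreover have "z \<in> convex_hull_of {y \<in> \<Omega>. e y \<sqsubseteq> a \<or> e y \<sqsubseteq> b}"
    if z: "z \<in> \<Omega>" and a: "a \<in> carrier L" and b: "b \<in> carrier L" and le: "e z \<sqsubseteq> a \<squnion> b" for z a b
  proof (cases "e z \<sqsubseteq> a \<or> e z \<sqsubseteq> b")
    case True
    then show ?thesis using z by (intro hull_inc) auto
  next
    case False
    have ez: "e z \<in> carrier L" using sat(1) z by (auto simp: configuration_def nonzero_def)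
    obtain a' b' where ab': "a' \<in> carrier L" "b' \<in> carrier L" "a' \<sqsubseteq> a" "b' \<sqsubseteq> b"
        "e z \<sqsubseteq> a' \<squnion> b'" "w a' < w (e z)" "w b' < w (e z)"
      using w[OF ez a b le] False by blast
    have not_le: "\<not> e z \<sqsubseteq> a'" "\<not> e z \<sqsubseteq> b'"
      using False le_trans[OF _ ab'(3) ez ab'(1) a] le_trans[OF _ ab'(4) ez ab'(2) b] by auto
    have "a' \<in> nonzero L"
    proof (rule ccontr)
      assume "a' \<notin> nonzero L"
      then have "a' \<squnion> b' \<sqsubseteq> b'" using ab' by (simp add: nonzero_def join_le_iff)
      then show False using le_trans[OF ab'(5)] not_le ez ab' by simp
    qed
    moreover have "b' \<in> nonzero L"
    proof (rule ccontr)
      assume "b' \<notin> nonzero L"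
      then have "a' \<squnion> b' \<sqsubseteq> a'" using ab' by (simp add: nonzero_def join_le_iff)
      then show False using le_trans[OF ab'(5)] not_le ez ab' by simp
    qed
    ultimately have "(a', b') \<in> splittings L w (e z)"
      using ab' by (simp add: splittings_def)
    then have "realized \<Omega> e z a' b'" using sat(4) z by auto
    then obtain s t where st: "s \<in> \<Omega>" "t \<in> \<Omega>" "e s = a'" "e t = b'" "z \<in> convex_hull_of {s, t}"
      by (auto simp: realized_def)
    then have "{s, t} \<subseteq> {y \<in> \<Omega>. e y \<sqsubseteq> a \<or> e y \<sqsubseteq> b}" using ab' by auto
    from hull_mono[OF this] show ?thesis using st(5) by blast
  qed
  ultimately have "saturated_configuration L w n \<Omega> e"
    using sat(1) by unfold_locales
  then show thesis by (rule that)
qed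

theorem theorem10p2:
  fixes L :: "'l gorder"
  assumes "lattice L" and "finite (carrier L)" and "lower_bounded_lattice L"
  shows "(\<exists>n. \<exists>f :: 'l \<Rightarrow> (nat \<Rightarrow> 'a::{division_ring, linordered_ring_strict}) set.
            lattice_embedding L (polytopes n) f \<and>
            plenary_map n L f \<and>
            zero_preserving L (polytopes n) f) \<and>
         (\<exists>n. \<exists>\<Omega> :: (nat \<Rightarrow> rat) set. \<exists>g.
            finite \<Omega> \<and>
            \<Omega> \<subseteq> {x \<in> coord_space n. \<forall>i. x i \<in> \<int>} \<and>
            plenary_set n \<Omega> \<and>
            lower_bounded_lattice (Co_rel n \<Omega>) \<and>
            lattice_embedding L (Co_rel n \<Omega>) g \<and>
            zero_preserving L (Co_rel n \<Omega>) g)"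
proof
  obtain w n and \<Omega> :: "(nat \<Rightarrow> 'a) set" and e where "saturated_configuration L w n \<Omega> e"
    using saturated_configuration_exists[OF assms] .
  then interpret saturated_configuration L w n \<Omega> e .
  show "\<exists>n. \<exists>f :: 'l \<Rightarrow> (nat \<Rightarrow> 'a) set. lattice_embedding L (polytopes n) f \<and>
      plenary_map n L f \<and> zero_preserving L (polytopes n) f"
    using lattice_embedding_hull_\<psi> plenary_map_hull_\<psi> zero_preserving_hull_\<psi> by blast
next
  obtain w n and \<Omega> :: "(nat \<Rightarrow> rat) set" and e where "saturated_configuration L w n \<Omega> e"
    using saturated_configuration_exists[OF assms] .
  then interpret saturated_configuration L w n \<Omega> e .
  show "\<exists>n. \<exists>\<Omega> :: (nat \<Rightarrow> rat) set. \<exists>g. finite \<Omega> \<and>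
      \<Omega> \<subseteq> {x \<in> coord_space n. \<forall>i. x i \<in> \<int>} \<and> plenary_set n \<Omega> \<and>
      lower_bounded_lattice (Co_rel n \<Omega>) \<and> lattice_embedding L (Co_rel n \<Omega>) g \<and>
      zero_preserving L (Co_rel n \<Omega>) g"
    using \<Omega> plenary_set_if_least_supports[OF \<Omega>(2,4)] lower_bounded_Co_rel
      lattice_embedding_\<psi> zero_preserving_\<psi>
    by (intro exI[of _ n] exI[of _ \<Omega>] exI[of _ \<psi>]) auto
qed

end
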